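(* For every integer $n\ge 2$, the number $t(n)$ of toppleable permutations in $S_n$ equals the number of acyclic orientations of the complete bipartite graph $K_{\lceil n/2\rceil,\lfloor n/2\rfloor+1}$ having a unique sink, which is a fixed prescribed vertex.
   Context: Toppling model. For an integer $n\ge 2$ let $L_n=\{-\lfloor (n+1)/2\rfloor,\dots,-1,0,1,\dots,\lfloor n/2\rfloor+1\}\subset\mathbb{Z}$; position $0$ is the origin. A configuration places chips carrying distinct integer labels at positions of $L_n$. A toppling move chooses a position $i$ holding at least two chips, chooses two chips $\alpha<\beta$ at $i$, and moves $\alpha$ to $i-1$ and $\beta$ to $i+1$. The process applies toppling moves (arbitrary choices) until no position holds two or more chips. For $\pi\in S_n$ and $r\in[n+1]$, the initial configuration $\pi^{(r)}$ has, for each $j=1,\dots,n$, one chip at position $-\lfloor (n-1)/2\rfloor+j-1$ labeled $\pi_j$ if $\pi_j<r$ and $\pi_j+1$ if $\pi_j\ge r$, plus a chip labeled $r$ at the origin. The final configuration does not depend on the choices and has at most one chip per position; reading chips left to right gives $\mathcal{T}(\pi,r)\in S_{n+1}$. $\pi$ is $r$-toppleable if $\mathcal{T}(\pi,r)$ is the identity, and toppleable if it is $r$-toppleable for all $r\in[n+1]$; $t(n)$ is the number of toppleable permutations in $S_n$. An acyclic orientation of a simple graph is an assignment of directions to its edges with no directed cycle; a sink is a vertex with no outgoing edge. *)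

theory Defs
  imports "HOL-Combinatorics.Permutations" "Graph_Theory.Kuratowski"
begin

definition positions :: "nat \<Rightarrow> int set" where
  "positions n = {- ((int n + 1) div 2) .. int n div 2 + 1}"

(* A configuration maps each position to the set of labels of the chips lying there. *)
type_synonym config = "int \<Rightarrow> nat set"

definition topple :: "nat \<Rightarrow> config \<Rightarrow> config \<Rightarrow> bool" where
  "topple n c d \<longleftrightarrow>
     (\<exists>i \<alpha> \<beta>. \<alpha> \<in> c i \<and> \<beta> \<in> c i \<and> \<alpha> < \<beta> \<and>
        i \<in> positions n \<and> i - 1 \<in> positions n \<and> i + 1 \<in> positions n \<and>
        d = c(i := c i - {\<alpha>, \<beta>},
              i - 1 := insert \<alpha> (c (i - 1)),
              i + 1 := insert \<beta> (c (i + 1))))"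

definition stable :: "config \<Rightarrow> bool" where
  "stable c \<longleftrightarrow> (\<forall>i. \<forall>\<alpha>\<in>c i. \<forall>\<beta>\<in>c i. \<alpha> = \<beta>)"

definition initial_config :: "nat \<Rightarrow> (nat \<Rightarrow> nat) \<Rightarrow> nat \<Rightarrow> config" where
  "initial_config n \<pi> r = (\<lambda>i.
     {if \<pi> j < r then \<pi> j else \<pi> j + 1 | j.
        j \<in> {1..n} \<and> i = - ((int n - 1) div 2) + int j - 1}
     \<union> (if i = 0 then {r} else {}))"

definition final_config :: "nat \<Rightarrow> (nat \<Rightarrow> nat) \<Rightarrow> nat \<Rightarrow> config" where
  "final_config n \<pi> r = (THE d. (topple n)\<^sup>*\<^sup>* (initial_config n \<pi> r) d \<and> stable d)"

definition read_config :: "nat \<Rightarrow> config \<Rightarrow> nat list" where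
  "read_config n c =
     concat (map (\<lambda>i. sorted_list_of_set (c i)) (sorted_list_of_set (positions n)))"

(* The word read off the final configuration is the one-line notation of a permutation of
   {1..n+1}; as usual for permutes, the permutation is extended by the identity. *)
definition toppling_perm :: "nat \<Rightarrow> (nat \<Rightarrow> nat) \<Rightarrow> nat \<Rightarrow> (nat \<Rightarrow> nat)" where
  "toppling_perm n \<pi> r =
     (\<lambda>k. if k \<in> {1..n + 1} then read_config n (final_config n \<pi> r) ! (k - 1) else k)"

definition r_toppleable :: "nat \<Rightarrow> nat \<Rightarrow> (nat \<Rightarrow> nat) \<Rightarrow> bool" where
  "r_toppleable n r \<pi> \<longleftrightarrow> toppling_perm n \<pi> r = id"

definition toppleable :: "nat \<Rightarrow> (nat \<Rightarrow> nat) \<Rightarrow> bool" where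
  "toppleable n \<pi> \<longleftrightarrow> (\<forall>r\<in>{1..n + 1}. r_toppleable n r \<pi>)"

definition num_toppleable :: "nat \<Rightarrow> nat" where
  "num_toppleable n = card {\<pi>. \<pi> permutes {1..n} \<and> toppleable n \<pi>}"

(* A simple graph is a symmetric loop-free digraph without parallel arcs (locale graph), each
   undirected edge being a pair of opposite arcs; an orientation keeps exactly one of the two. *)
definition acyclic_orientations :: "('a, 'b) pre_digraph \<Rightarrow> ('a \<times> 'a) set set" where
  "acyclic_orientations G =
     {D. D \<subseteq> arcs_ends G \<and>
         (\<forall>u v. (u, v) \<in> arcs_ends G \<longrightarrow> ((u, v) \<in> D \<longleftrightarrow> (v, u) \<notin> D)) \<and>
         acyclic D}"

definition sinks :: "('a, 'b) pre_digraph \<Rightarrow> ('a \<times> 'a) set \<Rightarrow> 'a set" where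
  "sinks G D = {v \<in> verts G. \<nexists>w. (v, w) \<in> D}"

end

(*
After k rounds of topplings, each started by the two chips at the origin and sweeping to both
ends, the extreme occupied positions hold their final chips: the smallest label among the left
half and the origin, and the largest among the right half and the origin.  In a round every
other chip moves at most one step towards the origin.  Hence the final word is sorted iff a
chip starting k > 0 places to the right of the origin has label at least k + 1, and dually on
the left.  Letting r vary, this turns toppleability into a band condition on the permutation.

With a = (n - 1) div 2 and q = n - a, the band permutations split into four blocks, two of them
free and two triangular, and the rook placements on a triangle are counted by Stirling numbers.
An acyclic orientation of a complete bipartite graph with unique sink v is a chain of nonempty
out-neighbourhoods, one for each vertex other than v on v's side.  Both counts are
  sum_k (k!)^2 S(a, k) S(q + 1, k + 1),
and the second one does not depend on the side containing v.
*)
theory Submission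
  imports Defs "HOL-Combinatorics.Stirling" "HOL-Library.Confluence"
begin

section \<open>Chain-valued maps and Stirling numbers\<close>

text \<open>No bijection between permutations and orientations is built; the two counts meet only in
  the sum. There k is, for orientations, the number of members of the chain and, for permutations,
  the number of j in {1..a} with \<pi> j at most q. Counting the values up to q then forces both
  free blocks to be k by k, whence (k!)^2, and the triangles to carry a - k and q - k rooks. The
  second triangle comes from a weak inequality, made strict by shifting one coordinate, which is why
  q + 1 appears next to a. The obstacle in toppling is that \<open>final_config\<close> is a
  definite description over arbitrary schedules. Uniqueness is proved within a class of
  configurations closed under toppling and containing the initial ones; after that one schedule may
  be chosen. The chosen rounds reproduce their own starting shape with one site less at each end.
  When the chips sent to the ends are the extreme labels, the remaining labels are again an
  interval, with offset \<open>lo\<close> raised by one, so sortedness is decided by induction over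
  the rounds.\<close>

lemma finite_funs_filter: "finite X \<Longrightarrow> finite Y \<Longrightarrow> finite {g \<in> X \<rightarrow>\<^sub>E Y. P g}"
  by (rule finite_subset[of _ "X \<rightarrow>\<^sub>E Y"]) (auto intro: finite_PiE)

section \<open>Surjections, and maps for which one prescribed value is optional\<close>

lemma card_almost_surj:
  assumes "finite X" "finite Y" "y \<in> Y"
  shows "card {g \<in> X \<rightarrow>\<^sub>E Y. Y - {y} \<subseteq> g ` X} =
    card {g \<in> X \<rightarrow>\<^sub>E Y. g ` X = Y} + card {g \<in> X \<rightarrow>\<^sub>E (Y - {y}). g ` X = Y - {y}}"
proof -
  have "{g \<in> X \<rightarrow>\<^sub>E Y. Y - {y} \<subseteq> g ` X} =
     {g \<in> X \<rightarrow>\<^sub>E Y. g ` X = Y} \<union> {g \<in> X \<rightarrow>\<^sub>E (Y - {y}). g ` X = Y - {y}}"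
  proof (intro equalityI subsetI)
    fix g assume g: "g \<in> {g \<in> X \<rightarrow>\<^sub>E Y. Y - {y} \<subseteq> g ` X}"
    then have "g ` X \<subseteq> Y" by auto
    show "g \<in> {g \<in> X \<rightarrow>\<^sub>E Y. g ` X = Y} \<union> {g \<in> X \<rightarrow>\<^sub>E (Y - {y}). g ` X = Y - {y}}"
    proof (cases "y \<in> g ` X")
      case True
      then have "g ` X = Y" using \<open>g ` X \<subseteq> Y\<close> g by blast
      then show ?thesis using g by blast
    next
      case False
      then have "g ` X = Y - {y}" using \<open>g ` X \<subseteq> Y\<close> g by blast
      moreover have "g \<in> X \<rightarrow>\<^sub>E (Y - {y})" using g False by (simp add: PiE_def Pi_def) blast
      ultimately show ?thesis by blast
    qed
  next
    fix g assume "g \<in> {g \<in> X \<rightarrow>\<^sub>E Y. g ` X = Y} \<union> {g \<in> X \<rightarrow>\<^sub>E (Y - {y}). g ` X = Y - {y}}"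
    then show "g \<in> {g \<in> X \<rightarrow>\<^sub>E Y. Y - {y} \<subseteq> g ` X}"
      by (auto simp: PiE_def Pi_def simp del: image_eqI)
  qed
  moreover have "{g \<in> X \<rightarrow>\<^sub>E Y. g ` X = Y} \<inter> {g \<in> X \<rightarrow>\<^sub>E (Y - {y}). g ` X = Y - {y}} = {}"
    using assms(3) by auto
  moreover have "finite {g \<in> X \<rightarrow>\<^sub>E Y. g ` X = Y}" "finite {g \<in> X \<rightarrow>\<^sub>E (Y - {y}). g ` X = Y - {y}}"
    using assms by (auto intro!: finite_funs_filter)
  ultimately show ?thesis by (simp add: card_Un_disjoint)
qed

text \<open>Deleting a point x with value y leaves a map that covers Y - {y} and may or may not hit
  y. The two cases give k! times the terms of the recurrence S(m+1, k) = k S(m, k) + S(m,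
  k-1).\<close>

lemma card_surj:
  assumes "finite X" "finite Y"
  shows "card {f \<in> X \<rightarrow>\<^sub>E Y. f ` X = Y} = fact (card Y) * Stirling (card X) (card Y)"
  using assms
proof (induction X arbitrary: Y rule: finite_induct)
  case empty
  then show ?case by (cases "card Y") (auto simp: card_gt_0_iff)
next
  case (insert x X)
  let ?S = "\<lambda>y. {g \<in> X \<rightarrow>\<^sub>E Y. Y - {y} \<subseteq> g ` X}"
  have eq: "{f \<in> insert x X \<rightarrow>\<^sub>E Y. f ` insert x X = Y} = (\<lambda>(y, g). g(x := y)) ` Sigma Y ?S"
  proof (intro equalityI subsetI)
    fix f assume f: "f \<in> {f \<in> insert x X \<rightarrow>\<^sub>E Y. f ` insert x X = Y}"
    have "f = (\<lambda>(y, g). g(x := y)) (f x, f(x := undefined))" by auto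
    moreover have "(f x, f(x := undefined)) \<in> Sigma Y ?S"
    proof -
      have "f(x := undefined) ` X = f ` X" using insert.hyps by (auto simp: image_iff)
      then show ?thesis using f insert.hyps by (auto simp: PiE_def extensional_def Pi_def)
    qed
    ultimately show "f \<in> (\<lambda>(y, g). g(x := y)) ` Sigma Y ?S" by (rule image_eqI)
  next
    fix f assume "f \<in> (\<lambda>(y, g). g(x := y)) ` Sigma Y ?S"
    then obtain y g where f: "f = g(x := y)" "y \<in> Y" "g \<in> X \<rightarrow>\<^sub>E Y" "Y - {y} \<subseteq> g ` X" by auto
    have "g(x := y) ` X = g ` X" using insert.hyps by (auto simp: image_iff)
    then show "f \<in> {f \<in> insert x X \<rightarrow>\<^sub>E Y. f ` insert x X = Y}"
      using f by (auto simp: PiE_def extensional_def Pi_def)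
  qed
  have "inj_on (\<lambda>(y, g). g(x := y)) (Sigma Y ?S)"
  proof (rule inj_onI, clarsimp)
    fix y g y' g' assume g: "g \<in> X \<rightarrow>\<^sub>E Y" "g' \<in> X \<rightarrow>\<^sub>E Y" and e: "g(x := y) = g'(x := y')"
    have "y = y'" using fun_cong[OF e, of x] by simp
    moreover have "g = g'"
    proof
      fix z show "g z = g' z" using fun_cong[OF e, of z] g insert.hyps(2)
        by (cases "z = x") (auto simp: PiE_def extensional_def)
    qed
    ultimately show "y = y' \<and> g = g'" by simp
  qed
  then have "card {f \<in> insert x X \<rightarrow>\<^sub>E Y. f ` insert x X = Y} = card (Sigma Y ?S)"
    unfolding eq by (rule card_image)
  also have "\<dots> = (\<Sum>y\<in>Y. card (?S y))"
    using insert by (intro card_SigmaI ballI finite_funs_filter) auto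
  also have "\<dots> = (\<Sum>y\<in>Y. fact (card Y) * Stirling (card X) (card Y) +
       fact (card Y - 1) * Stirling (card X) (card Y - 1))"
    using insert by (intro sum.cong refl) (subst card_almost_surj, auto)
  also have "\<dots> = fact (card Y) * Stirling (card (insert x X)) (card Y)"
    using insert by (cases "card Y") (auto simp: algebra_simps)
  finally show ?case .
qed

text \<open>The summands (k+1)! S(m, k+1) and k! S(m, k) are k! times the two terms of the Stirling
  recurrence. An optional value is thus the source of the shifted indices in the final sum.\<close>

lemma card_almost_surj_Stirling:
  assumes "finite X" "finite Y" "y \<in> Y" "card Y = Suc k"
  shows "card {g \<in> X \<rightarrow>\<^sub>E Y. Y - {y} \<subseteq> g ` X} = fact k * Stirling (Suc (card X)) (Suc k)"
  using assms by (subst card_almost_surj) (auto simp: card_surj algebra_simps)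

section \<open>Encoding of chain-valued maps\<close>

definition chain_funs :: "'a set \<Rightarrow> 'b set \<Rightarrow> ('a \<Rightarrow> 'b set) set" where
  "chain_funs X B = {f \<in> X \<rightarrow>\<^sub>E Pow B - {{}}. \<forall>x\<in>X. \<forall>y\<in>X. f x \<subseteq> f y \<or> f y \<subseteq> f x}"

text \<open>A map with chain \<open>S\<^sub>1 \<subset> \<dots> \<subset> S\<^sub>k\<close> as image is encoded by the index \<open>\<rho> x\<close> of the member
  assigned to \<open>x\<close> and the number \<open>\<tau> b\<close> of members missing \<open>b\<close>. The members are nonempty and distinct
  iff \<open>\<tau>\<close> takes all values below \<open>k\<close>; the value \<open>k\<close> is optional.\<close>

definition surj_pairs :: "'a set \<Rightarrow> 'b set \<Rightarrow> nat \<Rightarrow> (('a \<Rightarrow> nat) \<times> ('b \<Rightarrow> nat)) set" where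
  "surj_pairs X B k =
     {\<rho> \<in> X \<rightarrow>\<^sub>E {1..k}. \<rho> ` X = {1..k}} \<times> {\<tau> \<in> B \<rightarrow>\<^sub>E {0..k}. {0..k} - {k} \<subseteq> \<tau> ` B}"

text \<open>Counting members of the chain recovers all data: k as their number, \<rho> as a rank,
  \<tau> by the members omitting a point. Formulas in f alone make the encoding injective, also
  across different k.\<close>

lemma chain_levels:
  assumes "(\<rho>, \<tau>) \<in> surj_pairs X B k" and f: "f = (\<lambda>x\<in>X. {b \<in> B. \<tau> b < \<rho> x})"
  shows "k = card (f ` X)"
    and "\<rho> = (\<lambda>x\<in>X. card {S \<in> f ` X. S \<subseteq> f x})"
    and "\<tau> = (\<lambda>b\<in>B. card {S \<in> f ` X. b \<notin> S})"
    and "f \<in> chain_funs X B"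
proof -
  define L where "L = (\<lambda>i. {b \<in> B. \<tau> b < i})"
  have \<rho>: "\<rho> \<in> extensional X" "\<rho> ` X = {1..k}"
    and \<tau>: "\<tau> \<in> extensional B" "\<tau> ` B \<subseteq> {0..k}" "{0..k} - {k} \<subseteq> \<tau> ` B"
    using assms(1) by (auto simp: surj_pairs_def PiE_def Pi_def)
  have L: "L i \<subseteq> L j \<longleftrightarrow> i \<le> j" if "i \<in> {1..k}" "j \<in> {1..k}" for i j
  proof
    show "L i \<subseteq> L j" if "i \<le> j" using that by (auto simp: L_def)
    show "i \<le> j" if "L i \<subseteq> L j"
    proof (rule ccontr)
      assume "\<not> i \<le> j"
      \<comment> \<open>A point of level exactly j lies in \<open>L i\<close> but not in
        \<open>L j\<close>; it exists because all levels below k are attained.\<close>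
      then have "j \<in> {0..k} - {k}" using \<open>i \<in> {1..k}\<close> by auto
      then obtain b where "b \<in> B" "\<tau> b = j" using \<tau>(3) by fastforce
      then show False using that \<open>\<not> i \<le> j\<close> by (auto simp: L_def)
    qed
  qed
  have inj: "inj_on L {1..k}" by (rule inj_onI) (metis L order_antisym order_refl)
  have fx: "f x = L (\<rho> x)" if "x \<in> X" for x using that by (simp add: f L_def)
  have fX: "f ` X = L ` {1..k}" using fx unfolding \<rho>(2)[symmetric] by (auto simp: image_iff)
  show "k = card (f ` X)" unfolding fX using inj by (simp add: card_image)
  show "\<rho> = (\<lambda>x\<in>X. card {S \<in> f ` X. S \<subseteq> f x})"
  proof
    fix x show "\<rho> x = (\<lambda>x\<in>X. card {S \<in> f ` X. S \<subseteq> f x}) x"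
    proof (cases "x \<in> X")
      case True
      then have r: "\<rho> x \<in> {1..k}" using \<rho> by auto
      have "{S \<in> f ` X. S \<subseteq> f x} = L ` {i \<in> {1..k}. L i \<subseteq> L (\<rho> x)}"
        unfolding fX fx[OF True] by auto
      also have "{i \<in> {1..k}. L i \<subseteq> L (\<rho> x)} = {1..\<rho> x}"
      proof (rule set_eqI)
        fix i show "i \<in> {i \<in> {1..k}. L i \<subseteq> L (\<rho> x)} \<longleftrightarrow> i \<in> {1..\<rho> x}"
          using L[of i "\<rho> x"] r
          by (simp only: mem_Collect_eq atLeastAtMost_iff) (meson order_trans)
      qed
      finally have "{S \<in> f ` X. S \<subseteq> f x} = L ` {1..\<rho> x}" .
      then have "card {S \<in> f ` X. S \<subseteq> f x} = \<rho> x"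
        using inj_on_subset[OF inj, of "{1..\<rho> x}"] r by (simp add: card_image)
      then show ?thesis using True by simp
    qed (use \<rho> in \<open>auto simp: extensional_def\<close>)
  qed
  show "\<tau> = (\<lambda>b\<in>B. card {S \<in> f ` X. b \<notin> S})"
  proof
    fix b show "\<tau> b = (\<lambda>b\<in>B. card {S \<in> f ` X. b \<notin> S}) b"
    proof (cases "b \<in> B")
      case True
      then have r: "\<tau> b \<in> {0..k}" using \<tau> by auto
      have "{S \<in> f ` X. b \<notin> S} = L ` {1..\<tau> b}"
        unfolding fX using r True by (auto simp: image_iff L_def)
      then have "card {S \<in> f ` X. b \<notin> S} = \<tau> b"
        using inj_on_subset[OF inj, of "{1..\<tau> b}"] r by (simp add: card_image)
      then show ?thesis using True by simp
    qed (use \<tau> in \<open>auto simp: extensional_def\<close>)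
  qed
  have "f x \<noteq> {}" if "x \<in> X" for x
  proof -
    have "\<rho> x \<in> {1..k}" using that \<rho> by auto
    then have "0 \<in> {0..k} - {k}" by auto
    then have "0 \<in> \<tau> ` B" using \<tau>(3) by blast
    then show ?thesis using fx[OF that] \<open>\<rho> x \<in> {1..k}\<close> by (auto simp: L_def)
  qed
  moreover have "f x \<subseteq> f y \<or> f y \<subseteq> f x" if "x \<in> X" "y \<in> X" for x y
  proof -
    have "\<rho> x \<in> {1..k}" "\<rho> y \<in> {1..k}" using that \<rho> by auto
    then show ?thesis using fx L that nat_le_linear by metis
  qed
  ultimately show "f \<in> chain_funs X B"
    by (auto simp: chain_funs_def f PiE_def)
qed

text \<open>The rank is strictly monotone on the image chain, hence takes exactly the values 1, ...,
  k. A point belongs to a member iff the number of members omitting it is below the rank of that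
  member.\<close>

lemma chain_levels_exist:
  assumes "finite X" "finite B" "f \<in> chain_funs X B"
  shows "\<exists>k\<le>card X. \<exists>(\<rho>, \<tau>) \<in> surj_pairs X B k. f = (\<lambda>x\<in>X. {b \<in> B. \<tau> b < \<rho> x})"
proof -
  define C where "C = f ` X"
  define k where "k = card C"
  define rk where "rk = (\<lambda>S. card {T \<in> C. T \<subseteq> S})"
  define tk where "tk = (\<lambda>b. card {T \<in> C. b \<notin> T})"
  have f: "f \<in> extensional X" "\<And>x. x \<in> X \<Longrightarrow> f x \<subseteq> B \<and> f x \<noteq> {}"
    using assms(3) by (auto simp: chain_funs_def PiE_def)
  have chain: "S \<subseteq> T \<or> T \<subseteq> S" if "S \<in> C" "T \<in> C" for S T
    using assms(3) that unfolding chain_funs_def C_def by blast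
  have C: "S \<subseteq> B \<and> S \<noteq> {}" if "S \<in> C" for S using that f by (auto simp: C_def)
  have fin: "finite C" using assms(1) by (simp add: C_def)
  have less: "rk S < rk T" if "S \<in> C" "T \<in> C" "S \<subset> T" for S T
    unfolding rk_def using that fin by (intro psubset_card_mono) auto
  have inj: "inj_on rk C"
    by (rule inj_onI) (metis chain less nat_neq_iff psubsetI)
  have rk1: "rk S \<in> {1..k}" if "S \<in> C" for S
  proof -
    have "{T \<in> C. T \<subseteq> S} \<noteq> {}" using that by auto
    then have "rk S > 0" unfolding rk_def using fin by (simp add: card_gt_0_iff)
    moreover have "rk S \<le> k" unfolding rk_def k_def using fin by (intro card_mono) auto
    ultimately show ?thesis by simp
  qed
  have rkC: "rk ` C = {1..k}"
    using rk1 inj by (intro card_subset_eq) (auto simp: card_image k_def)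
  have tk_less: "tk b < rk S" if "S \<in> C" "b \<in> S" for S b
    unfolding tk_def rk_def using that fin chain by (intro psubset_card_mono) fastforce+
  have tk_ge: "rk S \<le> tk b" if "S \<in> C" "b \<notin> S" for S b
    unfolding tk_def rk_def using that fin by (intro card_mono) auto
  have tkB: "\<exists>b\<in>B. tk b = i" if "i < k" for i
  proof -
    have "Suc i \<in> rk ` C" using that rkC by auto
    then obtain S where S: "S \<in> C" "rk S = Suc i" by auto
    \<comment> \<open>For i > 0, take a point of S outside the member of rank i: at least i members
      omit it, and fewer than i + 1 because it lies in S. For i = 0 nonemptiness of S is
      enough.\<close>
    have "\<exists>b\<in>S. i \<le> tk b"
    proof (cases "i = 0")
      case True
      then show ?thesis using C S by auto
    next
      case False
      then have "i \<in> rk ` C" using that rkC by auto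
      then obtain T where T: "T \<in> C" "rk T = i" by auto
      then have "\<not> S \<subseteq> T" using chain less S by (metis Suc_n_not_le_n less_or_eq_imp_le n_not_Suc_n psubsetI)
      then show ?thesis using tk_ge T by blast
    qed
    then obtain b where "b \<in> S" "i \<le> tk b" by auto
    moreover have "tk b < Suc i" using tk_less S \<open>b \<in> S\<close> by metis
    ultimately show ?thesis using C S by (metis in_mono less_Suc_eq_le order_antisym)
  qed
  have tk_le: "tk b \<le> k" for b unfolding tk_def k_def using fin by (intro card_mono) auto
  define \<rho> where "\<rho> = (\<lambda>x\<in>X. rk (f x))"
  define \<tau> where "\<tau> = (\<lambda>b\<in>B. tk b)"
  have "\<rho> ` X = {1..k}" using rkC unfolding \<rho>_def C_def by (auto simp: image_image)
  moreover have "{0..k} - {k} \<subseteq> \<tau> ` B"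
  proof
    fix i assume "i \<in> {0..k} - {k}"
    then obtain b where "b \<in> B" "tk b = i" using tkB[of i] by auto
    then show "i \<in> \<tau> ` B" by (auto simp: \<tau>_def)
  qed
  ultimately have "(\<rho>, \<tau>) \<in> surj_pairs X B k"
    using tk_le by (auto simp: surj_pairs_def \<tau>_def \<rho>_def)
  moreover have "f = (\<lambda>x\<in>X. {b \<in> B. \<tau> b < \<rho> x})"
  proof
    fix x show "f x = (\<lambda>x\<in>X. {b \<in> B. \<tau> b < \<rho> x}) x"
    proof (cases "x \<in> X")
      case True
      then have "f x \<in> C" by (simp add: C_def)
      then have "b \<in> f x \<longleftrightarrow> tk b < rk (f x)" for b
        using tk_less[of "f x" b] tk_ge[of "f x" b] by (metis not_less)
      then show ?thesis using True C[OF \<open>f x \<in> C\<close>]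
        by (auto simp: \<tau>_def \<rho>_def)
    qed (use f in \<open>auto simp: extensional_def\<close>)
  qed
  moreover have "k \<le> card X" unfolding k_def C_def using assms(1) by (rule card_image_le)
  ultimately show ?thesis by blast
qed

lemma card_chain_funs:
  assumes "finite X" "finite B"
  shows "card (chain_funs X B) =
    (\<Sum>k\<le>card X. (fact k)\<^sup>2 * Stirling (card X) k * Stirling (Suc (card B)) (Suc k))"
proof -
  let ?F = "\<lambda>(k :: nat, \<rho>, \<tau>). (\<lambda>x\<in>X. {b \<in> B. \<tau> b < \<rho> x})"
  let ?D = "Sigma {..card X} (surj_pairs X B)"
  have "inj_on ?F ?D"
  proof (rule inj_onI, clarsimp)
    fix k \<rho> \<tau> k' \<rho>' \<tau>'
    assume a: "(\<rho>, \<tau>) \<in> surj_pairs X B k" "(\<rho>', \<tau>') \<in> surj_pairs X B k'"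
      and e: "(\<lambda>x\<in>X. {b \<in> B. \<tau> b < \<rho> x}) = (\<lambda>x\<in>X. {b \<in> B. \<tau>' b < \<rho>' x})"
    show "k = k' \<and> \<rho> = \<rho>' \<and> \<tau> = \<tau>'"
      by (intro conjI;
        rule trans[OF chain_levels(1)[OF a(1) refl] chain_levels(1)[OF a(2) e, symmetric]]
          trans[OF chain_levels(2)[OF a(1) refl] chain_levels(2)[OF a(2) e, symmetric]]
          trans[OF chain_levels(3)[OF a(1) refl] chain_levels(3)[OF a(2) e, symmetric]])
  qed
  moreover have "chain_funs X B = ?F ` ?D"
  proof (intro equalityI subsetI)
    fix f assume "f \<in> chain_funs X B"
    then obtain k \<rho> \<tau> where "k \<le> card X" "(\<rho>, \<tau>) \<in> surj_pairs X B k"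
      "f = (\<lambda>x\<in>X. {b \<in> B. \<tau> b < \<rho> x})"
      using chain_levels_exist[OF assms] by blast
    then show "f \<in> ?F ` ?D" by (intro image_eqI[of _ _ "(k, \<rho>, \<tau>)"]) auto
  next
    fix f assume "f \<in> ?F ` ?D"
    then obtain k \<rho> \<tau> where "(\<rho>, \<tau>) \<in> surj_pairs X B k"
      "f = (\<lambda>x\<in>X. {b \<in> B. \<tau> b < \<rho> x})" by auto
    then show "f \<in> chain_funs X B" by (rule chain_levels(4))
  qed
  ultimately have "card (chain_funs X B) = card ?D" by (simp add: card_image)
  also have "\<dots> = (\<Sum>k\<le>card X. card (surj_pairs X B k))"
    using assms by (intro card_SigmaI ballI)
      (simp_all add: surj_pairs_def finite_funs_filter)
  also have "\<dots> = (\<Sum>k\<le>card X. (fact k)\<^sup>2 * Stirling (card X) k * Stirling (Suc (card B)) (Suc k))"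
  proof (rule sum.cong[OF refl])
    fix k
    have "card {\<rho> \<in> X \<rightarrow>\<^sub>E {1..k}. \<rho> ` X = {1..k}} = fact k * Stirling (card X) k"
      using card_surj[of X "{1..k}"] assms by simp
    moreover have "card {\<tau> \<in> B \<rightarrow>\<^sub>E {0..k}. {0..k} - {k} \<subseteq> \<tau> ` B} = fact k * Stirling (Suc (card B)) (Suc k)"
      using assms by (intro card_almost_surj_Stirling) auto
    ultimately show "card (surj_pairs X B k) =
        (fact k)\<^sup>2 * Stirling (card X) k * Stirling (Suc (card B)) (Suc k)"
      unfolding surj_pairs_def card_cartesian_product by (simp only: power2_eq_square mult_ac)
  qed
  finally show ?thesis .
qed

text \<open>Expanding the last factor by the recurrence and shifting one of the two resulting sums
  allows the recurrence to be read backwards for the other factor. What remains, the sum of k!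
  (k+1)! S(m+1, k+1) S(q+1, k+1), is visibly symmetric. This is a duality of poly-Bernoulli
  numbers.\<close>

lemma Stirling_sum_symmetric:
  "(\<Sum>k\<le>m. (fact k)\<^sup>2 * Stirling m k * Stirling (Suc (Suc q)) (Suc k)) =
   (\<Sum>k\<le>q. (fact k)\<^sup>2 * Stirling q k * Stirling (Suc (Suc m)) (Suc k))" (is "?S m q = ?S q m")
proof -
  \<comment> \<open>A common upper limit for both sides; the sums extend to it because
    \<open>Stirling m k\<close> vanishes for k > m.\<close>
  define N where "N = Suc (m + q)"
  define F :: "nat \<Rightarrow> nat" where "F = fact"
  have F: "F (Suc k) = Suc k * F k" for k by (simp add: F_def)
  have ext: "?S m q = (\<Sum>k\<le>N. F k * F (Suc k) * (Stirling (Suc m) (Suc k) * Stirling (Suc q) (Suc k)))"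
    if "m + q < N" for m q
  proof -
    let ?f = "\<lambda>k. (F k)\<^sup>2 * Stirling m k * Stirling (Suc q) k"
    let ?g = "\<lambda>k. F k * F (Suc k) * Stirling m k * Stirling (Suc q) (Suc k)"
    have "(F k)\<^sup>2 * Stirling m k * Stirling (Suc (Suc q)) (Suc k) = ?f k + ?g k" for k
      unfolding Stirling.simps(4)[of "Suc q"] F by (simp only: power2_eq_square distrib_left mult_ac add_ac)
    moreover have "?S m q = (\<Sum>k\<le>N. (F k)\<^sup>2 * Stirling m k * Stirling (Suc (Suc q)) (Suc k))"
      unfolding F_def using that by (intro sum.mono_neutral_left) auto
    ultimately have "?S m q = (\<Sum>k\<le>N. ?f k) + (\<Sum>k\<le>N. ?g k)"
      by (simp only: sum.distrib)
    \<comment> \<open>The shift is free: the added term at \<open>Suc N\<close> vanishes because m <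
      Suc N, and the term at 0 because \<open>Stirling (Suc q) 0\<close> is 0.\<close>
    also have "(\<Sum>k\<le>N. ?f k) = (\<Sum>k\<le>Suc N. ?f k)"
      using that by (simp only: sum.atMost_Suc Stirling_less mult_0 mult_0_right add_0_right)
    also have "\<dots> = (\<Sum>k\<le>N. ?f (Suc k))"
      by (simp only: sum.atMost_Suc_shift Stirling.simps(3) mult_0_right add_0)
    also have "(\<Sum>k\<le>N. ?f (Suc k)) + (\<Sum>k\<le>N. ?g k) = (\<Sum>k\<le>N. ?f (Suc k) + ?g k)"
      by (simp only: sum.distrib)
    also have "\<dots> = (\<Sum>k\<le>N. F k * F (Suc k) * (Stirling (Suc m) (Suc k) * Stirling (Suc q) (Suc k)))"
      unfolding Stirling.simps(4)[of m] F
      by (simp only: power2_eq_square distrib_left distrib_right mult_ac add_ac)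
    finally show ?thesis .
  qed
  have "?S m q = (\<Sum>k\<le>N. F k * F (Suc k) * (Stirling (Suc m) (Suc k) * Stirling (Suc q) (Suc k)))"
    by (rule ext) (simp add: N_def)
  also have "\<dots> = (\<Sum>k\<le>N. F k * F (Suc k) * (Stirling (Suc q) (Suc k) * Stirling (Suc m) (Suc k)))"
    by (simp only: mult.commute[of "Stirling (Suc m) _"])
  also have "\<dots> = ?S q m"
    by (rule ext[symmetric]) (simp add: N_def)
  finally show ?thesis .
qed

section \<open>Acyclic orientations with a unique sink\<close>

text \<open>A map in \<open>chain_funs (U - {v}) V\<close> has the value \<open>undefined\<close> at
  v, so the empty out-neighbourhood of v is supplied explicitly.\<close>

definition orientation_of :: "'a set \<Rightarrow> 'a set \<Rightarrow> 'a \<Rightarrow> ('a \<Rightarrow> 'a set) \<Rightarrow> ('a \<times> 'a) set" where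
  "orientation_of U V v f =
     (let f' = f(v := {}) in
       {(u, w). u \<in> U \<and> w \<in> V \<and> w \<in> f' u} \<union> {(w, u). u \<in> U \<and> w \<in> V \<and> w \<notin> f' u})"

lemma acyclic_orientation_of:
  assumes UV: "U \<inter> V = {}" "finite U" "finite V" and "v \<in> U" and f: "f \<in> chain_funs (U - {v}) V"
  shows "acyclic (orientation_of U V v f)"
proof -
  define f' where "f' = f(v := {})"
  have sub: "f' u \<subseteq> V" if "u \<in> U" for u
    using f that by (auto simp: f'_def chain_funs_def)
  have chain: "f' u \<subseteq> f' u' \<or> f' u' \<subseteq> f' u" if "u \<in> U" "u' \<in> U" for u u'
    using f that by (auto simp: f'_def chain_funs_def)
  \<comment> \<open>A height that drops along every arc, even on U and odd on V. The union collects
    the out-neighbourhoods omitting x; by comparability it is a proper subset of every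
    out-neighbourhood containing x. Doubling leaves room for the odd heights in between.\<close>
  define h where "h = (\<lambda>x. if x \<in> U then 2 * card (f' x)
    else Suc (2 * card (\<Union>{f' u |u. u \<in> U \<and> x \<notin> f' u})))"
  have fin: "finite (f' u)" if "u \<in> U" for u using sub that UV finite_subset by blast
  have "(orientation_of U V v f)\<inverse> \<subseteq> measure h"
  proof (rule subrelI)
    fix y x assume "(y, x) \<in> (orientation_of U V v f)\<inverse>"
    then consider "x \<in> U" "y \<in> V" "y \<in> f' x" | "x \<in> V" "y \<in> U" "x \<notin> f' y"
      by (auto simp: orientation_of_def f'_def Let_def split: if_splits)
    then show "(y, x) \<in> measure h"
    proof cases
      case 1
      have "\<Union>{f' u |u. u \<in> U \<and> y \<notin> f' u} \<subset> f' x"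
        using chain[OF \<open>x \<in> U\<close>] 1 by blast
      then have "card (\<Union>{f' u |u. u \<in> U \<and> y \<notin> f' u}) < card (f' x)"
        using fin 1 by (intro psubset_card_mono)
      then show ?thesis using 1 UV by (auto simp: h_def)
    next
      case 2
      have "\<Union>{f' u |u. u \<in> U \<and> x \<notin> f' u} \<subseteq> V" using sub by blast
      then have "card (f' y) \<le> card (\<Union>{f' u |u. u \<in> U \<and> x \<notin> f' u})"
        using 2 UV by (intro card_mono) (auto intro: finite_subset)
      then show ?thesis using 2 UV by (auto simp: h_def)
    qed
  qed
  then have "acyclic ((orientation_of U V v f)\<inverse>)"
    using acyclic_subset wf_acyclic wf_measure by blast
  then show ?thesis by (simp add: acyclic_converse)
qed

text \<open>Acyclicity amounts to the absence of directed 4-cycles: incomparable out-neighbourhoods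
  produce one, and comparability yields acyclicity by \<open>acyclic_orientation_of\<close>. Since v
  is a sink, every vertex of V has an arc to v, so uniqueness of the sink means nonempty
  out-neighbourhoods on U - {v}.\<close>

lemma card_unique_sink_orientations:
  assumes G: "arcs_ends G = U \<times> V \<union> V \<times> U" "verts G = U \<union> V"
    and UV: "U \<inter> V = {}" "finite U" "finite V" and v: "v \<in> U"
  shows "card {D \<in> acyclic_orientations G. sinks G D = {v}} = card (chain_funs (U - {v}) V)"
proof -
  let ?A = "{D \<in> acyclic_orientations G. sinks G D = {v}}"
  let ?\<Phi> = "\<lambda>D. \<lambda>u\<in>U - {v}. {w \<in> V. (u, w) \<in> D}"
  let ?\<Psi> = "orientation_of U V v"
  have VU: "w \<notin> U" if "w \<in> V" for w using that UV(1) by blast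
  have sub: "D \<subseteq> U \<times> V \<union> V \<times> U"
    and or: "\<And>u w. u \<in> U \<Longrightarrow> w \<in> V \<Longrightarrow> (w, u) \<in> D \<longleftrightarrow> (u, w) \<notin> D"
    and ac: "acyclic D" and si: "sinks G D = {v}" if "D \<in> ?A" for D
  proof -
    have D: "D \<subseteq> U \<times> V \<union> V \<times> U"
      "\<forall>x y. (x, y) \<in> U \<times> V \<union> V \<times> U \<longrightarrow> ((x, y) \<in> D \<longleftrightarrow> (y, x) \<notin> D)" "acyclic D" "sinks G D = {v}"
      using that unfolding acyclic_orientations_def mem_Collect_eq G by blast+
    show "D \<subseteq> U \<times> V \<union> V \<times> U" "acyclic D" "sinks G D = {v}" by fact+
    fix u w assume "u \<in> U" "w \<in> V"
    then have "(w, u) \<in> U \<times> V \<union> V \<times> U" by blast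
    then show "(w, u) \<in> D \<longleftrightarrow> (u, w) \<notin> D" using D(2) by blast
  qed
  have "bij_betw ?\<Phi> ?A (chain_funs (U - {v}) V)"
  proof (rule bij_betw_byWitness[where f' = ?\<Psi>])
    show "\<forall>D\<in>?A. ?\<Psi> (?\<Phi> D) = D"
    proof
      fix D assume D: "D \<in> ?A"
      have "(v, w) \<notin> D" for w using si[OF D] unfolding sinks_def by blast
      then show "?\<Psi> (?\<Phi> D) = D"
        using sub[OF D] or[OF D] VU by (auto simp: orientation_of_def Let_def split: if_splits)
    qed
    show "\<forall>f\<in>chain_funs (U - {v}) V. ?\<Phi> (?\<Psi> f) = f"
    proof
      fix f assume f: "f \<in> chain_funs (U - {v}) V"
      show "?\<Phi> (?\<Psi> f) = f"
      proof
        fix u show "?\<Phi> (?\<Psi> f) u = f u"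
        proof (cases "u \<in> U - {v}")
          case True
          then have "f u \<subseteq> V" using f by (auto simp: chain_funs_def)
          then show ?thesis using True VU by (auto simp: orientation_of_def Let_def)
        next
          case False
          then have "f u = undefined" using f by (auto simp: chain_funs_def PiE_def extensional_def)
          then show ?thesis using False by (simp only: restrict_apply if_False)
        qed
      qed
    qed
    show "?\<Phi> ` ?A \<subseteq> chain_funs (U - {v}) V"
    proof (rule image_subsetI)
      fix D assume D: "D \<in> ?A"
      note sub = sub[OF D] and or = or[OF D] and ac = ac[OF D] and si = si[OF D]
      have "{w \<in> V. (u, w) \<in> D} \<noteq> {}" if u: "u \<in> U - {v}" for u
      proof -
        have "u \<notin> sinks G D" using si that by auto
        then obtain w where "(u, w) \<in> D" using u G by (auto simp: sinks_def)
        then show ?thesis using sub that VU by auto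
      qed
      moreover have "{w \<in> V. (u, w) \<in> D} \<subseteq> {w \<in> V. (u', w) \<in> D} \<or> {w \<in> V. (u', w) \<in> D} \<subseteq> {w \<in> V. (u, w) \<in> D}"
        if "u \<in> U" "u' \<in> U" for u u'
      proof (rule ccontr)
        assume "\<not> ?thesis"
        \<comment> \<open>These vertices form the directed cycle u, w, u', w', u.\<close>
        then obtain w w' where w: "w \<in> V" "(u, w) \<in> D" "(u', w) \<notin> D" "w' \<in> V" "(u', w') \<in> D" "(u, w') \<notin> D"
          by blast
        then have "(w, u') \<in> D" "(w', u) \<in> D" using or that by auto
        then have "(u, u) \<in> D\<^sup>+" using w by (meson trancl.simps)
        then show False using ac by (auto simp: acyclic_def)
      qed
      ultimately show "?\<Phi> D \<in> chain_funs (U - {v}) V"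
        unfolding chain_funs_def by (intro CollectI conjI restrict_PiE_iff[THEN iffD2] ballI) auto
    qed
    show "?\<Psi> ` chain_funs (U - {v}) V \<subseteq> ?A"
    proof (rule image_subsetI)
      fix f assume f: "f \<in> chain_funs (U - {v}) V"
      have "sinks G (?\<Psi> f) = {v}"
      proof (rule set_eqI)
        fix x
        have "x \<notin> sinks G (?\<Psi> f)" if x: "x \<in> U - {v}"
        proof -
          have "f x \<in> Pow V - {{}}" using f x by (auto simp: chain_funs_def)
          then obtain w where "w \<in> V" "w \<in> f x" by blast
          then have "(x, w) \<in> ?\<Psi> f" using x by (auto simp: orientation_of_def)
          then show ?thesis by (auto simp: sinks_def)
        qed
        moreover have "x \<notin> sinks G (?\<Psi> f)" if "x \<in> V"
          using v that by (auto simp: sinks_def orientation_of_def)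
        moreover have "v \<in> sinks G (?\<Psi> f)"
          using v VU G by (auto simp: sinks_def orientation_of_def)
        moreover have "x \<in> U \<union> V" if "x \<in> sinks G (?\<Psi> f)"
          using that G by (auto simp: sinks_def)
        ultimately show "x \<in> sinks G (?\<Psi> f) \<longleftrightarrow> x \<in> {v}" by blast
      qed
      moreover have "?\<Psi> f \<subseteq> arcs_ends G" unfolding G by (auto simp: orientation_of_def Let_def)
      moreover have "(x, y) \<in> ?\<Psi> f \<longleftrightarrow> (y, x) \<notin> ?\<Psi> f" if "(x, y) \<in> arcs_ends G" for x y
        using that VU unfolding G by (auto simp: orientation_of_def Let_def)
      ultimately show "?\<Psi> f \<in> ?A"
        using acyclic_orientation_of[OF UV v f] by (auto simp: acyclic_orientations_def)
    qed
  qed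
  then show ?thesis by (rule bij_betw_same_card)
qed

lemma card_unique_sink_orientations_complete_bipartite:
  assumes "complete_bipartite_digraph (Suc m) (Suc q) G" "v \<in> verts G"
  shows "card {D \<in> acyclic_orientations G. sinks G D = {v}} =
    (\<Sum>k\<le>m. (fact k)\<^sup>2 * Stirling m k * Stirling (Suc (Suc q)) (Suc k))"
proof -
  obtain U V where UV: "verts G = U \<union> V" "U \<inter> V = {}" "card U = Suc m" "card V = Suc q"
      "arcs_ends G = U \<times> V \<union> V \<times> U"
    using assms by (auto simp: complete_bipartite_digraph_def)
  have fin: "finite U" "finite V" using UV by (simp_all add: card_ge_0_finite)
  consider "v \<in> U" | "v \<in> V" using assms UV by auto
  then show ?thesis
  proof cases
    case 1
    then show ?thesis
      using card_unique_sink_orientations[OF UV(5,1,2) fin 1] fin UV by (simp add: card_chain_funs)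
  next
    case 2
    have "arcs_ends G = V \<times> U \<union> U \<times> V" "verts G = V \<union> U" "V \<inter> U = {}" using UV by auto
    from card_unique_sink_orientations[OF this fin(2,1) 2] show ?thesis
      unfolding Stirling_sum_symmetric[of m] using 2 fin UV by (simp add: card_chain_funs)
  qed
qed

section \<open>Permutations in a band\<close>

text \<open>A rook (i, j) is read as an arc joining consecutive elements i < j of a block, so
  placements of m - k rooks are the arc diagrams of set partitions of {1..m} into k blocks. The
  equation \<open>card T + k = m\<close> avoids truncated subtraction: k > m admits no
  placement.\<close>

definition staircase_rooks :: "nat \<Rightarrow> nat \<Rightarrow> (nat \<times> nat) set set" where
  "staircase_rooks m k =
     {T. T \<subseteq> {(i, j). 1 \<le> i \<and> i < j \<and> j \<le> m} \<and> inj_on fst T \<and> inj_on snd T \<and> card T + k = m}"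

lemma finite_staircase: "finite {(i, j). 1 \<le> i \<and> i < j \<and> j \<le> (m :: nat)}"
  by (rule finite_subset[of _ "{..m} \<times> {..m}"]) auto

lemma finite_staircase_rooks: "finite (staircase_rooks m k)"
  unfolding staircase_rooks_def
  by (rule finite_subset[OF _ finite_Pow_iff[THEN iffD2, OF finite_staircase[of m]]]) blast

text \<open>In the step, column m + 1 is empty or holds one rook; a placement of m - k rooks on the
  smaller triangle leaves exactly k of the rows 1, ..., m free for it.\<close>

lemma card_staircase_rooks: "card (staircase_rooks m k) = Stirling m k"
proof (induction m arbitrary: k)
  case 0
  have "staircase_rooks 0 k = (if k = 0 then {{}} else {})"
    by (auto simp: staircase_rooks_def)
  then show ?case by (cases k) auto
next
  case (Suc m)
  let ?tri = "\<lambda>m :: nat. {(i, j). 1 \<le> i \<and> i < j \<and> j \<le> m}"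
  let ?R1 = "{T \<in> staircase_rooks (Suc m) k. Suc m \<notin> snd ` T}"
  let ?R2 = "{T \<in> staircase_rooks (Suc m) k. Suc m \<in> snd ` T}"
  let ?S = "Sigma (staircase_rooks m k) (\<lambda>T. {1..m} - fst ` T)"
  let ?ins = "\<lambda>(T, i). insert (i, Suc m) T"
  have fin: "finite T" if "T \<subseteq> ?tri m" for T m using that finite_staircase finite_subset by blast
  have R: "T \<subseteq> ?tri m" "inj_on fst T" "inj_on snd T" "card T + k = m" if "T \<in> staircase_rooks m k" for T m k
    using that by (auto simp: staircase_rooks_def)
  have sub_less: "fst ` T \<subseteq> {1..m}" if "T \<subseteq> ?tri m" for T m using that by fastforce
  have "card ?R1 = (if k = 0 then 0 else Stirling m (k - 1))"
  proof (cases k)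
    case 0
    \<comment> \<open>For k = 0 there would be m + 1 rooks in only m rows.\<close>
    have "T \<notin> ?R1" for T
    proof
      assume T: "T \<in> ?R1"
      then have TR: "T \<in> staircase_rooks (Suc m) k" by simp
      have "fst ` T \<subseteq> {1..m}" using R(1)[OF TR] by fastforce
      then have "card (fst ` T) \<le> m" using card_mono[of "{1..m}"] by fastforce
      then show False using R(2,4)[OF TR] 0 by (simp add: card_image)
    qed
    then have "?R1 = {}" by blast
    then show ?thesis using 0 by (simp only: card.empty simp_thms if_True)
  next
    case (Suc k')
    have "?R1 = staircase_rooks m k'"
    proof (intro equalityI subsetI)
      fix T assume T: "T \<in> ?R1"
      then have TR: "T \<in> staircase_rooks (Suc m) k" by simp
      have "j \<le> m" if "(i, j) \<in> T" for i j
      proof -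
        have "j \<noteq> Suc m" using T that by force
        then show ?thesis using R(1)[OF TR] that by auto
      qed
      then have "T \<subseteq> ?tri m" using R(1)[OF TR] by auto
      then show "T \<in> staircase_rooks m k'" using R(2-4)[OF TR] Suc by (simp add: staircase_rooks_def)
    next
      fix T assume T: "T \<in> staircase_rooks m k'"
      have "Suc m \<notin> snd ` T" "T \<subseteq> ?tri (Suc m)" using R(1)[OF T] by fastforce+
      then show "T \<in> ?R1" using R(2-4)[OF T] Suc by (simp add: staircase_rooks_def)
    qed
    then show ?thesis using Suc.IH Suc by simp
  qed
  moreover have "card ?R2 = k * Stirling m k"
  proof -
    have "?R2 = ?ins ` ?S"
    proof (intro equalityI subsetI)
      fix T assume T: "T \<in> ?R2"
      then have TR: "T \<in> staircase_rooks (Suc m) k" by simp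
      from T obtain i where i: "(i, Suc m) \<in> T" by auto
      define T' where "T' = T - {(i, Suc m)}"
      have T': "1 \<le> i' \<and> i' < j \<and> j \<le> m \<and> i' \<noteq> i" if "(i', j) \<in> T'" for i' j
      proof -
        have "(i', j) \<in> T" "(i', j) \<noteq> (i, Suc m)" using that by (auto simp: T'_def)
        then have "i' \<noteq> i" "j \<noteq> Suc m"
          using inj_onD[OF R(2)[OF TR] _ _ i, of "(i', j)"]
            inj_onD[OF R(3)[OF TR] _ _ i, of "(i', j)"] by (metis fst_conv snd_conv)+
        then show ?thesis using R(1)[OF TR] \<open>(i', j) \<in> T\<close> by auto
      qed
      have "i \<notin> fst ` T'"
      proof
        assume "i \<in> fst ` T'"
        then obtain j where "(i, j) \<in> T'" by force
        then show False using T' by blast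
      qed
      moreover have "T' \<subseteq> ?tri m" by (rule subrelI) (use T' in simp)
      moreover have "inj_on fst T'" "inj_on snd T'"
        using R(2,3)[OF TR] by (auto simp: T'_def intro: inj_on_subset)
      moreover have "card T' + k = m" using R(4)[OF TR] card_Suc_Diff1[OF fin[OF R(1)[OF TR]] i]
        by (simp add: T'_def)
      moreover have "i \<in> {1..m}" using R(1)[OF TR] i by auto
      ultimately have "(T', i) \<in> ?S" by (simp add: staircase_rooks_def)
      moreover have "T = ?ins (T', i)" using i by (auto simp: T'_def)
      ultimately show "T \<in> ?ins ` ?S" by (rule rev_image_eqI)
    next
      fix T assume "T \<in> ?ins ` ?S"
      then obtain T' i where T: "T = insert (i, Suc m) T'" and T': "T' \<in> staircase_rooks m k"
        and i: "i \<in> {1..m} - fst ` T'" by auto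
      have "Suc m \<notin> snd ` T'" using R(1)[OF T'] by fastforce
      moreover from this have "(i, Suc m) \<notin> T'" by force
      moreover have "T \<subseteq> ?tri (Suc m)" using R(1)[OF T'] i unfolding T by auto
      moreover have "inj_on fst T" using R(2)[OF T'] i unfolding T by (auto simp: image_iff)
      moreover have "inj_on snd T" using R(3)[OF T'] \<open>Suc m \<notin> snd ` T'\<close> unfolding T
        by (auto simp: image_iff)
      ultimately show "T \<in> ?R2"
        using R(4)[OF T'] fin[OF R(1)[OF T']] unfolding T by (simp add: staircase_rooks_def)
    qed
    moreover have "inj_on ?ins ?S"
    proof (rule inj_onI, clarsimp)
      fix T i T' i'
      assume a: "T \<in> staircase_rooks m k" "T' \<in> staircase_rooks m k"
        and e: "insert (i, Suc m) T = insert (i', Suc m) T'"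
      have n: "(x, Suc m) \<notin> T" "(x, Suc m) \<notin> T'" for x using R(1)[OF a(1)] R(1)[OF a(2)] by auto
      then have "i = i'" using e by (metis insertE insertI1 prod.inject)
      then show "T = T' \<and> i = i'" using e n by (metis insert_ident)
    qed
    ultimately have "card ?R2 = card ?S" by (simp only: card_image)
    also have "\<dots> = (\<Sum>T\<in>staircase_rooks m k. card ({1..m} - fst ` T))"
      by (intro card_SigmaI finite_staircase_rooks) auto
    also have "\<dots> = (\<Sum>T\<in>staircase_rooks m k. k)"
    proof (rule sum.cong[OF refl])
      fix T assume T: "T \<in> staircase_rooks m k"
      have "fst ` T \<subseteq> {1..m}" using R(1)[OF T] by (rule sub_less)
      moreover have "card (fst ` T) = card T" using R(2)[OF T] by (rule card_image)
      ultimately show "card ({1..m} - fst ` T) = k"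
        using R(4)[OF T] by (subst card_Diff_subset) (auto intro: finite_subset)
    qed
    also have "\<dots> = k * Stirling m k" using Suc.IH by simp
    finally show ?thesis .
  qed
  moreover have "staircase_rooks (Suc m) k = ?R1 \<union> ?R2" by blast
  moreover have "card (?R1 \<union> ?R2) = card ?R1 + card ?R2"
    using finite_staircase_rooks[of "Suc m" k] by (intro card_Un_disjoint) auto
  ultimately have "card (staircase_rooks (Suc m) k) = (if k = 0 then 0 else Stirling m (k - 1)) + k * Stirling m k"
    by presburger
  then show ?case by (cases k) simp_all
qed

text \<open>With G fixed, such a permutation is a pair of independent maps, X onto Y and X' onto Y'.
  In the application all four sets have k elements, so each factor is k!.\<close>

lemma card_permutes_extending:
  assumes N: "finite N" "fst ` G \<union> X \<union> X' = N" "snd ` G \<union> Y \<union> Y' = N"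
    and disj: "X \<inter> X' = {}" "fst ` G \<inter> X = {}" "fst ` G \<inter> X' = {}"
    and G: "inj_on fst G"
  shows "card {\<pi>. \<pi> permutes N \<and> (\<forall>(x, y)\<in>G. \<pi> x = y) \<and> \<pi> ` X = Y \<and> \<pi> ` X' = Y'} =
    card {g \<in> X \<rightarrow>\<^sub>E Y. g ` X = Y} * card {h \<in> X' \<rightarrow>\<^sub>E Y'. h ` X' = Y'}" (is "card ?A = card ?B * card ?C")
proof -
  let ?\<Phi> = "\<lambda>\<pi>. (restrict \<pi> X, restrict \<pi> X')"
  define ext where "ext = (\<lambda>g h x. if x \<in> X then g x else if x \<in> X' then h x
    else if x \<in> fst ` G then THE y. (x, y) \<in> G else x)"
  have THE_G: "(THE y'. (x, y') \<in> G) = y" if "(x, y) \<in> G" for x y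
    using that by (intro the_equality) (metis G fst_conv inj_onD prod.inject)+
  have ext_G: "ext g h x = y" if "(x, y) \<in> G" for g h x y
  proof -
    have "x \<in> fst ` G" using that by force
    then show ?thesis using disj THE_G[OF that] by (auto simp: ext_def)
  qed
  have "bij_betw ?\<Phi> ?A (?B \<times> ?C)"
  proof (rule bij_betw_imageI)
    show "inj_on ?\<Phi> ?A"
    proof (rule inj_onI, rule ext)
      fix \<pi> \<sigma> x assume a: "\<pi> \<in> ?A" "\<sigma> \<in> ?A" and e: "?\<Phi> \<pi> = ?\<Phi> \<sigma>"
      consider "x \<in> X" | "x \<in> X'" | "x \<in> fst ` G" | "x \<notin> N" using N by blast
      then show "\<pi> x = \<sigma> x"
      proof cases
        case 3
        then show ?thesis using a by fastforce
      next
        case 4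
        then show ?thesis using a permutes_not_in[of \<pi> N x] permutes_not_in[of \<sigma> N x] by simp
      qed (use e in \<open>metis Pair_inject restrict_apply'\<close>)+
    qed
    show "?\<Phi> ` ?A = ?B \<times> ?C"
    proof (intro equalityI subsetI)
      fix p assume "p \<in> ?\<Phi> ` ?A"
      then show "p \<in> ?B \<times> ?C" by auto
    next
      fix p assume "p \<in> ?B \<times> ?C"
      then obtain g h where p: "p = (g, h)" and g: "g \<in> X \<rightarrow>\<^sub>E Y" "g ` X = Y" and h: "h \<in> X' \<rightarrow>\<^sub>E Y'" "h ` X' = Y'"
        by blast
      have X: "ext g h ` X = Y" using g by (auto simp: ext_def image_iff)
      have X': "ext g h ` X' = Y'" using h disj by (auto simp: ext_def image_iff)
      have "ext g h ` fst ` G = snd ` G"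
        unfolding image_image by (rule image_cong[OF refl]) (simp add: ext_G)
      \<comment> \<open>A surjective self-map of a finite set is injective, so it is enough that the
        three images cover N.\<close>
      then have "ext g h ` N = N" unfolding N(2)[symmetric] image_Un X X' using N(2,3) by simp
      moreover from this have "inj_on (ext g h) N" using N(1) by (simp add: eq_card_imp_inj_on)
      moreover have "ext g h x = x" if "x \<notin> N" for x using that N(2) by (auto simp: ext_def)
      ultimately have "ext g h permutes N" by (intro bij_imp_permutes) (auto simp: bij_betw_def)
      then have "ext g h \<in> ?A" using ext_G X X' by blast
      moreover have "restrict (ext g h) X = g" "restrict (ext g h) X' = h"
        using g h disj by (auto simp: ext_def fun_eq_iff PiE_def extensional_def restrict_def)
      ultimately show "p \<in> ?\<Phi> ` ?A" unfolding p by (intro image_eqI[of _ _ "ext g h"]) auto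
    qed
  qed
  then show ?thesis by (simp add: bij_betw_same_card card_cartesian_product)
qed

lemma card_band_permutations:
  "card {\<pi>. \<pi> permutes {1..a + q} \<and> (\<forall>j\<in>{1..a}. \<pi> j < j + q) \<and> (\<forall>j\<in>{a + 1..a + q}. j \<le> \<pi> j + a)} =
    (\<Sum>k\<le>a. (fact k)\<^sup>2 * Stirling a k * Stirling (Suc q) (Suc k))" (is "card ?P = _")
proof -
  let ?N = "{1..a + q}"
  \<comment> \<open>\<open>TT\<close> and \<open>UU\<close> record the entries in the two triangular
    blocks. In the first, \<pi> j = q + v < j + q says v < j; in the second, i \<le> \<pi> (a + i)
    becomes i < w for w = \<pi> (a + i) + 1, so that triangle has size q + 1. In the other two
    blocks the band condition holds automatically.\<close>
  define TT where "TT = (\<lambda>\<pi> :: nat \<Rightarrow> nat. {(v, j). j \<in> {1..a} \<and> 1 \<le> v \<and> \<pi> j = q + v})"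
  define UU where "UU = (\<lambda>\<pi> :: nat \<Rightarrow> nat. {(i, w). i \<in> {1..q} \<and> w = \<pi> (a + i) + 1 \<and> w \<le> q + 1})"
  define g where "g = (\<lambda>\<pi>. (a - card (TT \<pi>), TT \<pi>, UU \<pi>))"
  define I where "I = Sigma {..a} (\<lambda>k. staircase_rooks a k \<times> staircase_rooks (Suc q) (Suc k))"
  have finP: "finite ?P" by (rule finite_subset[of _ "{\<pi>. \<pi> permutes ?N}"]) (auto intro: finite_permutations)
  have finI: "finite I" by (simp add: I_def finite_staircase_rooks)
  have gP: "g ` ?P \<subseteq> I"
  proof (rule image_subsetI)
    fix \<pi> assume P: "\<pi> \<in> ?P"
    then have inj: "inj \<pi>" and im: "\<pi> ` ?N = ?N" by (auto simp: permutes_inj permutes_image)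
    have T_sub: "TT \<pi> \<subseteq> {(i, j). 1 \<le> i \<and> i < j \<and> j \<le> a}"
    proof (rule subrelI)
      fix v j assume "(v, j) \<in> TT \<pi>"
      then have j: "j \<in> {1..a}" "1 \<le> v" "\<pi> j = q + v" by (auto simp: TT_def)
      then have "\<pi> j < j + q" using P by blast
      then show "(v, j) \<in> {(i, j). 1 \<le> i \<and> i < j \<and> j \<le> a}" using j by simp
    qed
    have U_sub: "UU \<pi> \<subseteq> {(i, j). 1 \<le> i \<and> i < j \<and> j \<le> Suc q}"
    proof -
      have "i < \<pi> (a + i) + 1" if "i \<in> {1..q}" for i
      proof -
        have "a + i \<in> {a + 1..a + q}" using that by simp
        then have "a + i \<le> \<pi> (a + i) + a" using P by blast
        then show ?thesis by simp
      qed
      then show ?thesis by (auto simp: UU_def)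
    qed
    have T_inj: "inj_on fst (TT \<pi>)" "inj_on snd (TT \<pi>)"
      using injD[OF inj] by (auto simp: TT_def inj_on_def)
    have U_inj: "inj_on fst (UU \<pi>)" "inj_on snd (UU \<pi>)"
      by (auto simp: UU_def inj_on_def dest!: injD[OF inj])
    have T: "snd ` TT \<pi> = {j \<in> {1..a}. q < \<pi> j}"
    proof (intro equalityI subsetI)
      fix j assume "j \<in> {j \<in> {1..a}. q < \<pi> j}"
      then have "(\<pi> j - q, j) \<in> TT \<pi>" by (auto simp: TT_def)
      then show "j \<in> snd ` TT \<pi>" by force
    qed (auto simp: TT_def)
    have U: "(\<lambda>(i, w). a + i) ` UU \<pi> = {j \<in> {a + 1..a + q}. \<pi> j \<le> q}"
    proof (intro equalityI subsetI)
      fix j assume "j \<in> {j \<in> {a + 1..a + q}. \<pi> j \<le> q}"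
      then have "(j - a, \<pi> j + 1) \<in> UU \<pi>" "a + (j - a) = j" by (auto simp: UU_def)
      then show "j \<in> (\<lambda>(i, w). a + i) ` UU \<pi>" by force
    qed (auto simp: UU_def)
    have cT: "card (TT \<pi>) = card {j \<in> {1..a}. q < \<pi> j}"
      using card_image[OF T_inj(2)] T by simp
    have "inj_on (\<lambda>(i, w). a + i) (UU \<pi>)" by (auto simp: UU_def inj_on_def)
    from card_image[OF this] have cU: "card (UU \<pi>) = card {j \<in> {a + 1..a + q}. \<pi> j \<le> q}" using U by simp
    have "{1..a} = {j \<in> {1..a}. q < \<pi> j} \<union> {j \<in> {1..a}. \<pi> j \<le> q}" by auto
    then have "card {1..a} = card ({j \<in> {1..a}. q < \<pi> j} \<union> {j \<in> {1..a}. \<pi> j \<le> q})" by (rule arg_cong)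
    also have "\<dots> = card {j \<in> {1..a}. q < \<pi> j} + card {j \<in> {1..a}. \<pi> j \<le> q}"
      by (rule card_Un_disjoint) auto
    finally have "card {1..a} = card {j \<in> {1..a}. q < \<pi> j} + card {j \<in> {1..a}. \<pi> j \<le> q}" .
    moreover have "card {j \<in> ?N. \<pi> j \<le> q} = card {j \<in> {1..a}. \<pi> j \<le> q} + card {j \<in> {a + 1..a + q}. \<pi> j \<le> q}"
    proof -
      have "{j \<in> ?N. \<pi> j \<le> q} = {j \<in> {1..a}. \<pi> j \<le> q} \<union> {j \<in> {a + 1..a + q}. \<pi> j \<le> q}" by auto
      then have "card {j \<in> ?N. \<pi> j \<le> q} = card ({j \<in> {1..a}. \<pi> j \<le> q} \<union> {j \<in> {a + 1..a + q}. \<pi> j \<le> q})"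
        by (rule arg_cong)
      also have "\<dots> = card {j \<in> {1..a}. \<pi> j \<le> q} + card {j \<in> {a + 1..a + q}. \<pi> j \<le> q}"
        by (rule card_Un_disjoint) auto
      finally show ?thesis .
    qed
    moreover have "card {j \<in> ?N. \<pi> j \<le> q} = q"
    proof -
      have "\<pi> ` {j \<in> ?N. \<pi> j \<le> q} = {y \<in> \<pi> ` ?N. y \<le> q}" by auto
      also have "\<dots> = {1..q}" unfolding im by auto
      finally show ?thesis using card_image[OF inj_on_subset[OF inj subset_UNIV], of "{j \<in> ?N. \<pi> j \<le> q}"] by simp
    qed
    \<comment> \<open>If k of the first a positions take values at most q, the other q - k such
      values occur in the last q positions; these are the rooks of \<open>UU\<close>.\<close>
    ultimately have "card (TT \<pi>) + (a - card (TT \<pi>)) = a" "card (UU \<pi>) + Suc (a - card (TT \<pi>)) = Suc q"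
      unfolding cT cU by simp_all
    then show "g \<pi> \<in> I" using T_sub U_sub T_inj U_inj by (simp add: g_def I_def staircase_rooks_def)
  qed
  \<comment> \<open>A fibre fixes the triangular entries, and with them the rows and columns left
    for the free blocks; what remains are two bijections between k-element sets.\<close>
  have fib: "card {\<pi> \<in> ?P. g \<pi> = (k, T, U)} = (fact k)\<^sup>2" if I: "(k, T, U) \<in> I" for k T U
  proof -
    have T: "T \<subseteq> {(i, j). 1 \<le> i \<and> i < j \<and> j \<le> a}" "inj_on fst T" "inj_on snd T" "card T + k = a"
      and U: "U \<subseteq> {(i, j). 1 \<le> i \<and> i < j \<and> j \<le> Suc q}" "inj_on fst U" "inj_on snd U" "card U + k = q"
      using I by (auto simp: I_def staircase_rooks_def)
    have finTU: "finite T" "finite U" using T(1) U(1) finite_staircase finite_subset by blast+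
    define G where "G = (\<lambda>(v, j). (j, q + v)) ` T \<union> (\<lambda>(i, w). (a + i, w - 1)) ` U"
    define X where "X = {1..a} - snd ` T"
    define X' where "X' = {a + 1..a + q} - (\<lambda>i. a + i) ` fst ` U"
    define Y where "Y = {1..q} - (\<lambda>w. w - 1) ` snd ` U"
    define Y' where "Y' = {q + 1..a + q} - (\<lambda>v. q + v) ` fst ` T"
    have fstG: "fst ` G = snd ` T \<union> (\<lambda>i. a + i) ` fst ` U"
      unfolding G_def image_Un image_image by (simp add: case_prod_beta)
    have sndG: "snd ` G = (\<lambda>v. q + v) ` fst ` T \<union> (\<lambda>w. w - 1) ` snd ` U"
      unfolding G_def image_Un image_image by (simp add: case_prod_beta)
    have sub: "snd ` T \<subseteq> {1..a}" "(\<lambda>i. a + i) ` fst ` U \<subseteq> {a + 1..a + q}"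
      "(\<lambda>w. w - 1) ` snd ` U \<subseteq> {1..q}" "(\<lambda>v. q + v) ` fst ` T \<subseteq> {q + 1..a + q}"
      using T(1) U(1) by fastforce+
    have injw: "inj_on (\<lambda>w. w - 1) (snd ` U)"
      by (rule inj_on_subset[of _ "{1..}"]) (use U(1) in \<open>auto simp: inj_on_def\<close>)
    have cards: "card X = k" "card X' = k" "card Y = k" "card Y' = k"
      unfolding X_def X'_def Y_def Y'_def using T(2-4) U(2-4) sub finTU injw
      by (simp_all add: card_Diff_subset card_image)
    have "inj_on fst G"
    proof (rule inj_onI)
      fix p p' assume p: "p \<in> G" "p' \<in> G" "fst p = fst p'"
      have "j \<le> a" if "(v, j) \<in> T" for v j using T(1) that by auto
      moreover have "1 \<le> i" if "(i, w) \<in> U" for i w using U(1) that by auto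
      ultimately show "p = p'"
        using p inj_onD[OF T(3)] inj_onD[OF U(2)] unfolding G_def by fastforce
    qed
    have "{\<pi> \<in> ?P. g \<pi> = (k, T, U)} =
      {\<pi>. \<pi> permutes ?N \<and> (\<forall>(x, y)\<in>G. \<pi> x = y) \<and> \<pi> ` X = Y \<and> \<pi> ` X' = Y'}" (is "?L = ?R")
    proof (intro equalityI subsetI)
      fix \<pi> assume L: "\<pi> \<in> ?L"
      then have perm: "\<pi> permutes ?N" and TT: "TT \<pi> = T" and UU: "UU \<pi> = U" by (auto simp: g_def)
      have inj: "inj \<pi>" using perm by (rule permutes_inj)
      have N: "\<pi> j \<in> ?N" if "j \<in> ?N" for j using permutes_in_image[OF perm] that by blast
      have G: "\<pi> x = y" if "(x, y) \<in> G" for x y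
        using that unfolding G_def TT[symmetric] UU[symmetric] by (auto simp: TT_def UU_def)
      have "\<pi> ` X \<subseteq> Y"
      proof (rule image_subsetI)
        fix j assume j: "j \<in> X"
        then have "(\<pi> j - q, j) \<notin> TT \<pi>" unfolding TT X_def by force
        then have "\<pi> j \<le> q" using j by (auto simp: TT_def X_def)
        moreover have "\<pi> j \<notin> (\<lambda>w. w - 1) ` snd ` U"
        proof
          assume "\<pi> j \<in> (\<lambda>w. w - 1) ` snd ` U"
          then obtain i where "i \<in> {1..q}" "\<pi> j = \<pi> (a + i)" unfolding UU[symmetric] by (auto simp: UU_def)
          then show False using injD[OF inj] j by (fastforce simp: X_def)
        qed
        ultimately show "\<pi> j \<in> Y" using N[of j] j by (auto simp: X_def Y_def)
      qed
      \<comment> \<open>Inclusion suffices, as \<pi> is injective and X and Y both have k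
        elements.\<close>
      then have "\<pi> ` X = Y" using cards card_image[OF inj_on_subset[OF inj subset_UNIV], of X]
        by (intro card_subset_eq) (auto simp: Y_def)
      moreover have "\<pi> ` X' \<subseteq> Y'"
      proof (rule image_subsetI)
        fix j assume j: "j \<in> X'"
        then have ij: "j - a \<in> {1..q}" "a + (j - a) = j" by (auto simp: X'_def)
        then have "j - a \<notin> fst ` U" using j unfolding X'_def by (metis DiffD2 imageI)
        then have "(j - a, \<pi> j + 1) \<notin> UU \<pi>" unfolding UU by force
        then have "q < \<pi> j" using ij(1,2) by (simp add: UU_def)
        moreover have "\<pi> j \<notin> (\<lambda>v. q + v) ` fst ` T"
        proof
          assume "\<pi> j \<in> (\<lambda>v. q + v) ` fst ` T"
          then obtain i where "i \<in> {1..a}" "\<pi> j = \<pi> i" unfolding TT[symmetric] by (auto simp: TT_def)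
          then show False using injD[OF inj] j by (fastforce simp: X'_def)
        qed
        ultimately show "\<pi> j \<in> Y'" using N[of j] j by (auto simp: X'_def Y'_def)
      qed
      then have "\<pi> ` X' = Y'" using cards card_image[OF inj_on_subset[OF inj subset_UNIV], of X']
        by (intro card_subset_eq) (auto simp: Y'_def)
      ultimately show "\<pi> \<in> ?R" using perm G by blast
    next
      fix \<pi> assume R: "\<pi> \<in> ?R"
      have XY: "\<pi> j \<in> Y" if "j \<in> X" for j using R that by blast
      have XY': "\<pi> j \<in> Y'" if "j \<in> X'" for j using R that by blast
      have "\<forall>(x, y)\<in>G. \<pi> x = y" using R by simp
      then have GG: "\<pi> x = y" if "(x, y) \<in> G" for x y using that by fast
      have GT: "\<pi> j = q + v" if "(v, j) \<in> T" for v j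
      proof -
        have "(j, q + v) \<in> G" using that unfolding G_def by force
        then show ?thesis by (rule GG)
      qed
      have GU: "\<pi> (a + i) = w - 1" if "(i, w) \<in> U" for i w
      proof -
        have "(a + i, w - 1) \<in> G" using that unfolding G_def by force
        then show ?thesis by (rule GG)
      qed
      have top: "\<pi> j \<le> q \<or> (\<pi> j - q, j) \<in> T \<and> q < \<pi> j" if "j \<in> {1..a}" for j
      proof (cases "j \<in> snd ` T")
        case True
        then obtain v where v: "(v, j) \<in> T" by force
        then have "1 \<le> v" using T(1) by auto
        then show ?thesis using GT[OF v] v by simp
      next
        case False
        then show ?thesis using XY[of j] that by (simp add: X_def Y_def)
      qed
      have bot: "q < \<pi> (a + i) \<or> (i, \<pi> (a + i) + 1) \<in> U" if "i \<in> {1..q}" for i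
      proof (cases "i \<in> fst ` U")
        case True
        then obtain w where w: "(i, w) \<in> U" by force
        then have "1 < w" using U(1) by auto
        then show ?thesis using GU[OF w] w by simp
      next
        case False
        then have "a + i \<in> X'" using that by (simp add: X'_def inj_image_mem_iff)
        from XY'[OF this] show ?thesis by (simp add: Y'_def)
      qed
      have "\<pi> j < j + q" if j: "j \<in> {1..a}" for j
        using top[OF j]
      proof
        assume "(\<pi> j - q, j) \<in> T \<and> q < \<pi> j"
        then have "\<pi> j - q < j" "q < \<pi> j" using T(1) by auto
        then show ?thesis by simp
      qed (use j in simp)
      moreover have "j \<le> \<pi> j + a" if j: "j \<in> {a + 1..a + q}" for j
      proof -
        have i: "j - a \<in> {1..q}" "a + (j - a) = j" using j by auto
        from bot[OF i(1)] show ?thesis unfolding i(2)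
        proof
          assume "(j - a, \<pi> j + 1) \<in> U"
          then have "j - a < \<pi> j + 1" using U(1) by auto
          then show ?thesis by simp
        qed (use j in simp)
      qed
      moreover have "TT \<pi> = T"
      proof (intro equalityI subrelI)
        fix v j assume "(v, j) \<in> TT \<pi>"
        then show "(v, j) \<in> T" using top[of j] by (auto simp: TT_def)
      next
        fix v j assume "(v, j) \<in> T"
        then show "(v, j) \<in> TT \<pi>" using GT T(1) by (force simp: TT_def)
      qed
      moreover have "UU \<pi> = U"
      proof (intro equalityI subrelI)
        fix i w assume "(i, w) \<in> UU \<pi>"
        then show "(i, w) \<in> U" using bot[of i] by (auto simp: UU_def)
      next
        fix i w assume iw: "(i, w) \<in> U"
        then have "1 \<le> i" "i < w" "w \<le> Suc q" using U(1) by auto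
        then show "(i, w) \<in> UU \<pi>" using GU[OF iw] by (auto simp: UU_def)
      qed
      ultimately show "\<pi> \<in> ?L" using R T(4) by (auto simp: g_def)
    qed
    moreover have "card ?R = (fact k)\<^sup>2"
    proof -
      have "card ?R = card {g \<in> X \<rightarrow>\<^sub>E Y. g ` X = Y} * card {h \<in> X' \<rightarrow>\<^sub>E Y'. h ` X' = Y'}"
      proof (rule card_permutes_extending)
        have N: "?N = {1..a} \<union> {a + 1..a + q}" "?N = {1..q} \<union> {q + 1..a + q}" by auto
        show "fst ` G \<union> X \<union> X' = ?N"
          unfolding fstG X_def X'_def N(1) using sub(1,2) by blast
        show "snd ` G \<union> Y \<union> Y' = ?N"
          unfolding sndG Y_def Y'_def N(2) using sub(3,4) by blast
        have "{1..a} \<inter> {a + 1..a + q} = {}" by auto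
        then show "X \<inter> X' = {}" "fst ` G \<inter> X = {}" "fst ` G \<inter> X' = {}"
          unfolding fstG X_def X'_def using sub(1,2) by blast+
      qed (use \<open>inj_on fst G\<close> in auto)
      moreover have "finite X" "finite X'" "finite Y" "finite Y'"
        by (simp_all add: X_def X'_def Y_def Y'_def)
      ultimately show ?thesis by (simp add: card_surj cards power2_eq_square)
    qed
    ultimately show ?thesis by (simp only:)
  qed
  have "card ?P = (\<Sum>i\<in>I. card {\<pi> \<in> ?P. g \<pi> = i})"
    using sum.group[OF finP finI gP, of "\<lambda>_. 1 :: nat"] by (simp only: card_eq_sum)
  also have "\<dots> = (\<Sum>(k, T, U)\<in>I. (fact k)\<^sup>2)"
    by (intro sum.cong refl) (auto simp only: fib split: prod.split)
  also have "\<dots> = (\<Sum>k\<le>a. (fact k)\<^sup>2 * Stirling a k * Stirling (Suc q) (Suc k))"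
    unfolding I_def
    by (subst sum.Sigma[symmetric])
      (auto simp: finite_staircase_rooks card_cartesian_product card_staircase_rooks case_prod_beta
        simp del: Stirling.simps intro!: sum.cong)
  finally show ?thesis .
qed

section \<open>Toppling\<close>

text \<open>The empty site between doubled ones keeps doubled sites from being neighbours, so a
  toppling never puts a third chip anywhere. Mere non-adjacency would not be preserved: in 2, 1, 2
  toppling one end doubles the middle next to the other end.\<close>

definition alternating :: "config \<Rightarrow> bool" where
  "alternating c \<longleftrightarrow> (\<forall>i. finite (c i) \<and> card (c i) \<le> 2) \<and>
     (\<forall>i j. i < j \<longrightarrow> card (c i) = 2 \<longrightarrow> card (c j) = 2 \<longrightarrow> (\<exists>k. i < k \<and> k < j \<and> c k = {}))"

definition fire :: "int \<Rightarrow> config \<Rightarrow> config" where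
  "fire i c = c(i := {}, i - 1 := insert (Min (c i)) (c (i - 1)), i + 1 := insert (Max (c i)) (c (i + 1)))"

lemma topple_iff_fire:
  assumes "alternating c"
  shows "topple n c d \<longleftrightarrow> (\<exists>i. card (c i) = 2 \<and>
    i \<in> positions n \<and> i - 1 \<in> positions n \<and> i + 1 \<in> positions n \<and> d = fire i c)"
proof
  assume "topple n c d"
  then obtain i \<alpha> \<beta> where i: "\<alpha> \<in> c i" "\<beta> \<in> c i" "\<alpha> < \<beta>"
    "i \<in> positions n" "i - 1 \<in> positions n" "i + 1 \<in> positions n"
    "d = c(i := c i - {\<alpha>, \<beta>}, i - 1 := insert \<alpha> (c (i - 1)), i + 1 := insert \<beta> (c (i + 1)))"
    unfolding topple_def by blast
  have "card {\<alpha>, \<beta>} = 2" using i by simp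
  then have "finite (c i)" "{\<alpha>, \<beta>} \<subseteq> c i" "card (c i) \<le> card {\<alpha>, \<beta>}"
    using i assms by (simp_all only: alternating_def) auto
  then have ci: "c i = {\<alpha>, \<beta>}" by (rule card_seteq[symmetric])
  then have "Min (c i) = \<alpha>" "Max (c i) = \<beta>" using i(3) by auto
  then have "d = fire i c" using i(7) ci by (simp add: fire_def)
  then show "\<exists>i. card (c i) = 2 \<and>
    i \<in> positions n \<and> i - 1 \<in> positions n \<and> i + 1 \<in> positions n \<and> d = fire i c"
    using i ci by (intro exI[of _ i]) simp
next
  assume "\<exists>i. card (c i) = 2 \<and>
    i \<in> positions n \<and> i - 1 \<in> positions n \<and> i + 1 \<in> positions n \<and> d = fire i c"
  then obtain i where i: "card (c i) = 2"
    "i \<in> positions n" "i - 1 \<in> positions n" "i + 1 \<in> positions n" "d = fire i c" by blast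
  then obtain x y where "c i = {x, y}" "x \<noteq> y" by (auto simp: card_2_iff)
  then obtain \<alpha> \<beta> where ci: "c i = {\<alpha>, \<beta>}" "\<alpha> < \<beta>" by (metis insert_commute nat_neq_iff)
  then have "d = c(i := c i - {\<alpha>, \<beta>}, i - 1 := insert \<alpha> (c (i - 1)), i + 1 := insert \<beta> (c (i + 1)))"
    using i(5) by (simp add: fire_def)
  then show "topple n c d" unfolding topple_def using i ci by blast
qed

lemma alternating_neighbour:
  assumes "alternating c" "card (c i) = 2" "\<bar>j - i\<bar> = 1"
  shows "card (c j) \<le> 1"
proof (rule ccontr)
  assume "\<not> card (c j) \<le> 1"
  then have "card (c j) = 2" using assms(1) unfolding alternating_def by (metis One_nat_def le_SucE numeral_2_eq_2)
  then have "\<exists>k. (i < k \<and> k < j) \<or> (j < k \<and> k < i)"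
    using assms unfolding alternating_def by (metis abs_zero eq_iff_diff_eq_0 linorder_neqE zero_neq_one)
  then show False using assms(3) by auto
qed

text \<open>The emptied site i separates whatever lies on its two sides. If i - 1 becomes doubled,
  it was occupied before, so the empty site that separated i from a doubled site further left lies
  strictly beyond i - 1 and still separates. The site i + 1 is symmetric.\<close>

lemma alternating_fire:
  assumes c: "alternating c" and i: "card (c i) = 2"
  shows "alternating (fire i c)"
  unfolding alternating_def
proof (intro conjI allI impI)
  fix j
  have fin: "finite (c j)" "card (c j) \<le> 2" for j using c by (auto simp: alternating_def)
  show "finite (fire i c j)" using fin by (simp add: fire_def)
  have "card (insert x (c j)) \<le> 2" if "\<bar>j - i\<bar> = 1" for x
    using alternating_neighbour[OF c i that] fin by (simp add: card_insert_if)
  then show "card (fire i c j) \<le> 2" using fin by (auto simp: fire_def)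
next
  fix j k assume jk: "j < k" "card (fire i c j) = 2" "card (fire i c k) = 2"
  have far: "fire i c m = c m" if "\<bar>m - i\<bar> > 1" for m using that by (auto simp: fire_def)
  have fi: "fire i c i = {}" by (simp add: fire_def)
  have gap: "\<exists>k. l < k \<and> k < m \<and> c k = {}" if "l < m" "card (c l) = 2" "card (c m) = 2" for l m
    using c that by (auto simp: alternating_def)
  have old: "card (c m) = 2" if "card (fire i c m) = 2" "\<bar>m - i\<bar> > 1" for m
    using that far by simp
  have ne: "m \<noteq> i" if "card (fire i c m) = 2" for m using that fi by auto
  have nonempty: "c m \<noteq> {}" if "card (fire i c m) = 2" "\<bar>m - i\<bar> = 1" for m
  proof -
    have "m = i - 1 \<or> m = i + 1" using that by auto
    then show ?thesis using that(1) by (auto simp: fire_def)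
  qed
  consider "j < i" "i < k" | "k < i" | "i < j"
    using ne[OF jk(2)] ne[OF jk(3)] jk(1) by linarith
  then show "\<exists>m. j < m \<and> m < k \<and> fire i c m = {}"
  proof cases
    case 1
    then show ?thesis using fi by blast
  next
    case 2
    then have j: "card (c j) = 2" using jk old by simp
    show ?thesis
    proof (cases "k = i - 1")
      case True
      obtain m where m: "j < m" "m < i" "c m = {}" using gap[of j i] j i 2 jk(1) by auto
      then have "m \<noteq> k" using nonempty[OF jk(3)] True by auto
      then have "m < k" using m True by simp
      then show ?thesis using m far[of m] True by auto
    next
      case False
      then have "card (c k) = 2" using jk old 2 by simp
      then obtain m where "j < m" "m < k" "c m = {}" using gap[OF jk(1) j] by blast
      then show ?thesis using far[of m] 2 by auto
    qed
  next
    case 3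
    then have k: "card (c k) = 2" using jk old by simp
    show ?thesis
    proof (cases "j = i + 1")
      case True
      obtain m where m: "i < m" "m < k" "c m = {}" using gap[of i k] k i 3 jk(1) by auto
      then have "m \<noteq> j" using nonempty[OF jk(2)] True by auto
      then have "j < m" using m True by simp
      then show ?thesis using m far[of m] True by auto
    next
      case False
      then have "card (c j) = 2" using jk old 3 by simp
      then obtain m where "j < m" "m < k" "c m = {}" using gap[OF jk(1) _ k] by blast
      then show ?thesis using far[of m] 3 by auto
    qed
  qed
qed

lemma fire_commute: "\<bar>i - j\<bar> > 1 \<Longrightarrow> fire i (fire j c) = fire j (fire i c)"
proof -
  assume far: "\<bar>i - j\<bar> > 1"
  \<comment> \<open>Moving given chips is separated from selecting them: distant topplings do not
    change each other's chips, and at distance 2 the insertions into the common neighbour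
    commute.\<close>
  define push where "push = (\<lambda>i a b (c :: config).
    c(i := {}, i - 1 := insert a (c (i - 1)), i + 1 := insert b (c (i + 1))))"
  have fire: "fire i c = push i (Min (c i)) (Max (c i)) c" for i c by (simp add: push_def fire_def)
  have "push j a b c i = c i" "push i a b c j = c j" for a b using far by (auto simp: push_def)
  then show ?thesis unfolding fire using far by (auto simp: push_def fun_eq_iff insert_commute add.commute)
qed

lemma alternating_topple: "alternating c \<Longrightarrow> topple n c d \<Longrightarrow> alternating d"
  by (auto simp: topple_iff_fire intro: alternating_fire)

text \<open>In an alternating configuration at most one toppling is possible at each position, and
  unstable positions are never adjacent, so that topplings at distinct positions commute.\<close>

lemma confluent_topple: "confluentp (\<lambda>c d. alternating c \<and> topple n c d)"
proof (rule strong_confluentp_imp_confluentp, rule strong_confluentpI)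
  let ?r = "\<lambda>c d. alternating c \<and> topple n c d"
  fix c d e assume d: "?r c d" and e: "?r c e"
  then have c: "alternating c" by simp
  obtain i where i: "card (c i) = 2" "i \<in> positions n" "i - 1 \<in> positions n" "i + 1 \<in> positions n" "d = fire i c"
    using d topple_iff_fire by blast
  obtain j where j: "card (c j) = 2" "j \<in> positions n" "j - 1 \<in> positions n" "j + 1 \<in> positions n" "e = fire j c"
    using e topple_iff_fire by blast
  show "\<exists>u. ?r\<^sup>*\<^sup>* d u \<and> ?r\<^sup>=\<^sup>= e u"
  proof (cases "i = j")
    case True
    then show ?thesis using i j by auto
  next
    case False
    have "\<bar>j - i\<bar> \<noteq> 1" using alternating_neighbour[OF c i(1), of j] j(1) by auto
    then have far: "\<bar>i - j\<bar> > 1" using False by linarith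
    then have "d j = c j" "e i = c i" by (auto simp: i(5) j(5) fire_def)
    then have "?r d (fire j d)" "?r e (fire i e)"
      using alternating_topple d e i j topple_iff_fire by metis+
    moreover have "fire j d = fire i e" using fire_commute[OF far] by (simp add: i(5) j(5))
    ultimately show ?thesis by auto
  qed
qed

lemma stable_imp_not_topple: "stable d \<Longrightarrow> \<not> topple n d e"
  unfolding stable_def topple_def by (metis less_irrefl)

text \<open>This justifies the description in \<open>final_config\<close>: any one schedule ending
  in a stable configuration determines the result.\<close>

lemma stable_unique:
  assumes c: "alternating c" and d: "(topple n)\<^sup>*\<^sup>* c d" "stable d" and e: "(topple n)\<^sup>*\<^sup>* c e" "stable e"
  shows "d = e"
proof -
  let ?r = "\<lambda>c d. alternating c \<and> topple n c d"
  have "?r\<^sup>*\<^sup>* c x \<and> alternating x" if "(topple n)\<^sup>*\<^sup>* c x" for x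
    using that
  proof induction
    case (step y z)
    then show ?case using alternating_topple by (metis (mono_tags, lifting) rtranclp.rtrancl_into_rtrancl)
  qed (use c in simp)
  then have "?r\<^sup>*\<^sup>* c d" "?r\<^sup>*\<^sup>* c e" using d(1) e(1) by blast+
  from confluentpD[OF confluent_topple this] obtain u where "?r\<^sup>*\<^sup>* d u" "?r\<^sup>*\<^sup>* e u" by (elim exE conjE)
  moreover have "x = u" if "?r\<^sup>*\<^sup>* x u" "stable x" for x u
    using that(1) by (cases rule: converse_rtranclpE) (use stable_imp_not_topple that(2) in auto)
  ultimately have "d = u" "e = u" using d(2) e(2) by blast+
  then show ?thesis by simp
qed

section \<open>Sweeps away from the origin\<close>

text \<open>One pass of bubble sort: f picks the element carried on, g the one left in place;
  \<open>fold f ys c\<close> leaves at the end.\<close>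

fun deposits :: "('a \<Rightarrow> 'a \<Rightarrow> 'a) \<Rightarrow> ('a \<Rightarrow> 'a \<Rightarrow> 'a) \<Rightarrow> 'a \<Rightarrow> 'a list \<Rightarrow> 'a list" where
  "deposits f g c [] = []"
| "deposits f g c (y # ys) = g y c # deposits f g (f y c) ys"

lemma length_deposits [simp]: "length (deposits f g c ys) = length ys"
  by (induction ys arbitrary: c) auto

lemma nth_deposits: "k < length ys \<Longrightarrow> deposits f g c ys ! k = g (ys ! k) (fold f (take k ys) c)"
  by (induction ys arbitrary: c k) (auto simp: nth_Cons split: nat.splits)

lemma mset_deposits:
  assumes "\<And>a b. {#f a b, g a b#} = {#a, b#}"
  shows "add_mset (fold f ys c) (mset (deposits f g c ys)) = add_mset c (mset ys)"
proof (induction ys arbitrary: c)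
  case (Cons y ys)
  have "add_mset (fold f ys (f y c)) (mset (deposits f g (f y c) ys)) = add_mset (f y c) (mset ys)"
    by (rule Cons)
  then have "add_mset (g y c) (add_mset (fold f ys (f y c)) (mset (deposits f g (f y c) ys))) =
      {#f y c, g y c#} + mset ys" by simp
  then show ?case unfolding assms by (simp add: add_mset_commute)
qed simp

text \<open>The result of toppling successively at \<open>s\<close>, \<open>s + d\<close>, \<open>s + 2d\<close> and so on, where \<open>s\<close> holds \<open>p\<close> and \<open>c\<close> and
  the positions beyond it hold \<open>ys\<close>: the chip \<open>c\<close> is carried along, each next position keeps one
  of its two chips in favour of the other, and \<open>p\<close> is left behind at \<open>s - d\<close>.\<close>

definition swept :: "int \<Rightarrow> ('a \<Rightarrow> 'a \<Rightarrow> 'a) \<Rightarrow> ('a \<Rightarrow> 'a \<Rightarrow> 'a) \<Rightarrow> int \<Rightarrow> 'a \<Rightarrow> 'a \<Rightarrow> 'a list \<Rightarrow> (int \<Rightarrow> 'a set) \<Rightarrow> int \<Rightarrow> 'a set" where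
  "swept d f g s p c ys C = (\<lambda>i. let k = d * (i - s) in
     if k = -1 then insert p (C i)
     else if 0 \<le> k \<and> k < int (length ys) then {deposits f g c ys ! nat k}
     else if k = int (length ys) then {}
     else if k = int (length ys) + 1 then {fold f ys c}
     else C i)"

text \<open>Both directions are treated at once: d is the direction of travel, and
  \<open>p = g p c\<close> says that p is the chip toppled backwards.\<close>

lemma topple_push:
  assumes dir: "d = 1 \<and> f = max \<and> g = min \<or> d = -1 \<and> f = min \<and> g = max"
    and C: "C s = {p, c}" "p \<noteq> c" "p = g p c"
    and pos: "s \<in> positions n" "s - d \<in> positions n" "s + d \<in> positions n"
  shows "topple n C (C(s := {}, s - d := insert p (C (s - d)), s + d := insert c (C (s + d))))"
  using dir
proof
  assume d: "d = 1 \<and> f = max \<and> g = min"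
  then have "p < c" using C(2,3) by (auto simp: min_def split: if_splits)
  then show ?thesis unfolding topple_def using d C(1) pos
    by (intro exI[of _ s] exI[of _ p] exI[of _ c]) simp
next
  assume d: "d = -1 \<and> f = min \<and> g = max"
  then have "c < p" using C(2,3) by (auto simp: max_def split: if_splits)
  have "C(s := {}, s + 1 := insert p (C (s + 1)), s - 1 := insert c (C (s - 1))) =
      C(s := C s - {c, p}, s - 1 := insert c (C (s - 1)), s + 1 := insert p (C (s + 1)))"
    using C(1) by (intro ext) auto
  then show ?thesis unfolding topple_def using \<open>c < p\<close> d C(1) pos
    by (intro exI[of _ s] exI[of _ c] exI[of _ p]) simp
qed

lemma topple_sweep:
  assumes dir: "d = 1 \<and> f = max \<and> g = min \<or> d = -1 \<and> f = min \<and> g = max"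
    and C: "C s = {p, c}" "p \<noteq> c" "p = g p c"
      "\<And>k. k < length ys \<Longrightarrow> C (s + d * (int k + 1)) = {ys ! k}"
      "C (s + d * (int (length ys) + 1)) = {}"
    and "distinct (c # ys)"
    and pos: "\<And>k. -1 \<le> k \<Longrightarrow> k \<le> int (length ys) + 1 \<Longrightarrow> s + d * k \<in> positions n"
  shows "(topple n)\<^sup>*\<^sup>* C (swept d f g s p c ys C)"
  using C \<open>distinct (c # ys)\<close> pos
proof (induction ys arbitrary: C s p c)
  case (Nil C s p c)
  let ?C = "C(s := {}, s - d := insert p (C (s - d)), s + d := insert c (C (s + d)))"
  have "s \<in> positions n" "s - d \<in> positions n" "s + d \<in> positions n"
    using Nil.prems(7)[of 0] Nil.prems(7)[of "-1"] Nil.prems(7)[of 1] by simp_all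
  with dir Nil.prems(1-3) have "topple n C ?C" by (rule topple_push)
  moreover have "swept d f g s p c [] C = ?C"
    using dir Nil.prems(5) by (auto simp: swept_def fun_eq_iff Let_def)
  ultimately show ?case by (simp only: r_into_rtranclp)
next
  case (Cons y ys C s p c)
  let ?C = "C(s := {}, s - d := insert p (C (s - d)), s + d := insert c (C (s + d)))"
  have d: "d = 1 \<or> d = -1" using dir by auto
  have "s \<in> positions n" "s - d \<in> positions n" "s + d \<in> positions n"
    using Cons.prems(7)[of 0] Cons.prems(7)[of "-1"] Cons.prems(7)[of 1] by simp_all
  with dir Cons.prems(1-3) have "topple n C ?C" by (rule topple_push)
  \<comment> \<open>The same situation one site further on: y and c share it, \<open>g y c\<close>
    will fall back onto the emptied site s, and \<open>f y c\<close> travels on.\<close>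
  moreover have "(topple n)\<^sup>*\<^sup>* ?C (swept d f g (s + d) (g y c) (f y c) ys ?C)"
  proof (rule Cons.IH)
    have y: "C (s + d) = {y}" using Cons.prems(4)[of 0] by simp
    have yc: "y \<noteq> c" using Cons.prems(6) by auto
    have "{g y c, f y c} = {y, c}" using dir by (cases "y \<le> c") (auto simp: min_def max_def)
    then show "?C (s + d) = {g y c, f y c}" using y by (simp add: insert_commute)
    show "g y c \<noteq> f y c" "g y c = g (g y c) (f y c)"
      using yc dir by (cases "y \<le> c"; auto simp: min_def max_def)+
    have far: "?C (s + d + d * (int k + 1)) = C (s + d * (int (Suc k) + 1))" for k
      using d by (elim disjE) (simp_all add: algebra_simps)
    show "?C (s + d + d * (int k + 1)) = {ys ! k}" if "k < length ys" for k
      unfolding far using Cons.prems(4)[of "Suc k"] that by simp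
    show "?C (s + d + d * (int (length ys) + 1)) = {}"
      unfolding far using Cons.prems(5) by simp
    show "distinct (f y c # ys)" using Cons.prems(6) dir by (cases "y \<le> c") (auto simp: min_def max_def)
    show "s + d + d * k \<in> positions n" if "-1 \<le> k" "k \<le> int (length ys) + 1" for k
      using Cons.prems(7)[of "k + 1"] that by (simp add: algebra_simps)
  qed
  moreover have "swept d f g (s + d) (g y c) (f y c) ys ?C = swept d f g s p c (y # ys) C"
  proof
    fix i
    define k where "k = d * (i - s)"
    have k: "d * (i - (s + d)) = k - 1" "i = s + d * k" using d by (auto simp: k_def algebra_simps)
    show "swept d f g (s + d) (g y c) (f y c) ys ?C i = swept d f g s p c (y # ys) C i"
    proof -
      consider "k = -1" | "k = 0" | "1 \<le> k \<and> k \<le> int (length ys)"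
        | "k = int (length ys) + 1" | "k = int (length ys) + 2" | "k < -1 \<or> k > int (length ys) + 2" by linarith
      then show ?thesis
      proof cases
        case 1
        then have "i = s - d" "i \<noteq> s" "s - d \<noteq> s + d" using d k(2) by auto
        with 1 show ?thesis unfolding swept_def Let_def k(1) k_def[symmetric] by simp
      next
        case 2
        then have "i = s" "s \<noteq> s - d" "s \<noteq> s + d" using d k(2) by auto
        with 2 show ?thesis unfolding swept_def Let_def k(1) k_def[symmetric] by simp
      next
        case 3
        moreover from this have "nat k = Suc (nat (k - 1))" by linarith
        ultimately show ?thesis unfolding swept_def Let_def k(1) k_def[symmetric] by simp
      next
        case 6
        moreover from this have "i \<noteq> s" "i \<noteq> s - d" "i \<noteq> s + d" using d k(2) by auto
        ultimately show ?thesis unfolding swept_def Let_def k(1) k_def[symmetric] by auto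
      qed (unfold swept_def Let_def k(1) k_def[symmetric], simp_all)
    qed
  qed
  ultimately show ?case by (metis converse_rtranclp_into_rtranclp)
qed

section \<open>Effect of one round on the label inequalities\<close>

lemma card_le_Max:
  fixes S :: "nat set"
  assumes "finite S" "S \<noteq> {}" "\<And>x. x \<in> S \<Longrightarrow> b \<le> x"
  shows "b + card S \<le> Max S + 1"
proof -
  have "S \<subseteq> {b..Max S}" using assms by auto
  then have "card S \<le> card {b..Max S}" by (intro card_mono) auto
  moreover have "b \<le> Max S" using assms by simp
  ultimately show ?thesis by simp
qed

lemma Min_le_card:
  fixes S :: "nat set"
  assumes "finite S" "S \<noteq> {}" "\<And>x. x \<in> S \<Longrightarrow> x \<le> b"
  shows "Min S + card S \<le> b + 1"
proof -
  have "S \<subseteq> {Min S..b}" using assms by auto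
  then have "card S \<le> card {Min S..b}" by (intro card_mono) auto
  moreover have "Min S \<le> b" using assms by simp
  ultimately show ?thesis by simp
qed

text \<open>Here \<open>L\<close> and \<open>R\<close> list the chips on the two sides of the origin, both read outwards, and the labels
  in play are those from \<open>lo + 1\<close> to \<open>lo + length L + length R + 2\<close>.\<close>

definition balanced :: "nat \<Rightarrow> nat list \<Rightarrow> nat list \<Rightarrow> bool" where
  "balanced lo L R \<longleftrightarrow> (\<forall>k<length R. lo + k + 2 \<le> R ! k) \<and>
     (\<forall>k<length L. L ! k + k \<le> lo + length L + length R + 1)"

text \<open>The chip deposited in place of \<open>R ! k\<close> is the smaller of it and the largest
  of w, y and the k chips before it. In the balanced case these k + 2 distinct labels are at least
  \<open>lo + 2\<close>, so their maximum meets the new bound by itself and only the condition on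
  \<open>R ! k\<close> matters; its bound is unchanged, since its index drops by one while
  \<open>lo\<close> rises by one. The condition on y amounts to y \<noteq> lo + 1, which is forced
  once \<open>lo + 1\<close> leaves on the left. The left side is dual.\<close>

lemma balanced_step:
  assumes uw: "u < w" and dist: "distinct (u # w # (x # L) @ y # R)"
    and labels: "set (u # w # (x # L) @ y # R) = {lo + 1..lo + (length L + length R + 4)}"
  shows "fold min L (min x u) = lo + 1 \<and> fold max R (max y w) = lo + (length L + length R + 4) \<and>
      balanced (lo + 1) (deposits min max (min x u) L) (deposits max min (max y w) R) \<longleftrightarrow>
    balanced lo (x # L) (y # R)"
proof -
  let ?N = "length L + length R + 4"
  have fmax: "fold max ys (max y w) = Max (set (w # y # ys))" for ys
    using Max.set_eq_fold[of w "y # ys"] by simp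
  have fmin: "fold min xs (min x u) = Min (set (u # x # xs))" for xs
    using Min.set_eq_fold[of u "x # xs"] by simp
  have bounds: "lo + 1 \<le> v" "v \<le> lo + ?N" if "v \<in> set (u # w # (x # L) @ y # R)" for v
    using that unfolding labels by auto
  have R2: "deposits max min (max y w) R ! k = min (R ! k) (Max (set (w # y # take k R)))"
    if "k < length R" for k using nth_deposits[OF that, of max min] fmax by simp
  have L2: "deposits min max (min x u) L ! k = max (L ! k) (Min (set (u # x # take k L)))"
    if "k < length L" for k using nth_deposits[OF that, of min max] fmin by simp
  show ?thesis
  proof (intro iffI)
    assume b: "balanced lo (x # L) (y # R)"
    have bR: "lo + k + 2 \<le> (y # R) ! k" if "k < Suc (length R)" for k
      using that b by (simp add: balanced_def)
    have bL: "(x # L) ! k + k \<le> lo + ?N - 1" if "k < Suc (length L)" for k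
    proof -
      have "(x # L) ! k + k \<le> lo + length (x # L) + length (y # R) + 1"
        using b that unfolding balanced_def length_Cons by blast
      then show ?thesis by simp
    qed
    have geR: "lo + 2 \<le> v" if v: "v \<in> set (w # y # R)" for v
    proof -
      consider "v = w" | "v \<in> set (y # R)" using v by auto
      then show ?thesis
      proof cases
        case 1
        then show ?thesis using uw bounds[of u] by simp
      next
        case 2
        then obtain k where "k < Suc (length R)" "v = (y # R) ! k"
          by (metis in_set_conv_nth length_Cons)
        then show ?thesis using bR[of k] by simp
      qed
    qed
    have leL: "v \<le> lo + ?N - 1" if v: "v \<in> set (u # x # L)" for v
    proof -
      consider "v = u" | "v \<in> set (x # L)" using v by auto
      then show ?thesis
      proof cases
        case 1
        then show ?thesis using uw bounds[of w] by simp
      next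
        case 2
        then obtain k where "k < Suc (length L)" "v = (x # L) ! k"
          by (metis in_set_conv_nth length_Cons)
        then show ?thesis using bL[of k] by simp
      qed
    qed
    \<comment> \<open>All right-hand labels exceed \<open>lo + 1\<close>, and so does w because u <
      w; hence the smallest label is among the chips swept left.\<close>
    have "lo + 1 \<in> set (u # w # (x # L) @ y # R)" unfolding labels by simp
    then have "lo + 1 \<in> set (u # x # L)" using geR[of "lo + 1"] by auto
    then have "Min (set (u # x # L)) = lo + 1"
      by (intro Min_eqI) (use bounds(1) in auto)
    moreover have "lo + ?N \<in> set (u # w # (x # L) @ y # R)" unfolding labels by simp
    then have "lo + ?N \<in> set (w # y # R)" using leL[of "lo + ?N"] by auto
    then have "Max (set (w # y # R)) = lo + ?N"
      by (intro Max_eqI) (use bounds(2) in auto)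
    moreover have "lo + 1 + k + 2 \<le> deposits max min (max y w) R ! k" if k: "k < length R" for k
    proof -
      have "set (w # y # take k R) \<subseteq> set (w # y # R)" using set_take_subset[of k R] by auto
      then have "lo + 2 + card (set (w # y # take k R)) \<le> Max (set (w # y # take k R)) + 1"
        using geR by (intro card_le_Max) auto
      moreover have "distinct (w # y # take k R)" using dist by (auto dest: in_set_takeD)
      then have "card (set (w # y # take k R)) = k + 2" using k by (subst distinct_card) auto
      ultimately show ?thesis using bR[of "Suc k"] k unfolding R2[OF k] by simp
    qed
    moreover have "deposits min max (min x u) L ! k + k \<le> lo + 1 + length L + length R + 1" if k: "k < length L" for k
    proof -
      have "set (u # x # take k L) \<subseteq> set (u # x # L)" using set_take_subset[of k L] by auto
      then have "Min (set (u # x # take k L)) + card (set (u # x # take k L)) \<le> lo + ?N - 1 + 1"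
        using leL by (intro Min_le_card) auto
      moreover have "distinct (u # x # take k L)" using dist by (auto dest: in_set_takeD)
      then have "card (set (u # x # take k L)) = k + 2" using k by (subst distinct_card) auto
      ultimately show ?thesis using bL[of "Suc k"] k unfolding L2[OF k] by simp
    qed
    ultimately show "fold min L (min x u) = lo + 1 \<and> fold max R (max y w) = lo + ?N \<and>
        balanced (lo + 1) (deposits min max (min x u) L) (deposits max min (max y w) R)"
      unfolding fmax fmin balanced_def by simp
  next
    assume *: "fold min L (min x u) = lo + 1 \<and> fold max R (max y w) = lo + ?N \<and>
        balanced (lo + 1) (deposits min max (min x u) L) (deposits max min (max y w) R)"
    have "lo + 1 \<in> set (u # x # L)" using * Min_in[of "set (u # x # L)"] unfolding fmin by auto
    then have "y \<noteq> lo + 1" using dist by auto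
    then have "lo + 2 \<le> y" using bounds(1)[of y] by simp
    moreover have "lo + ?N \<in> set (w # y # R)" using * Max_in[of "set (w # y # R)"] unfolding fmax by auto
    then have "x \<noteq> lo + ?N" using dist by auto
    then have "x \<le> lo + ?N - 1" using bounds(2)[of x] by simp
    moreover have "Suc (Suc (Suc (lo + k))) \<le> R ! k" if k: "k < length R" for k
    proof -
      have "lo + 1 + k + 2 \<le> deposits max min (max y w) R ! k" using * k by (simp add: balanced_def)
      then show ?thesis unfolding R2[OF k] by simp
    qed
    moreover have "L ! k + k \<le> Suc (Suc (lo + length L + length R))" if k: "k < length L" for k
    proof -
      have "deposits min max (min x u) L ! k + k \<le> lo + 1 + length L + length R + 1"
        using * k by (simp add: balanced_def)
      then show ?thesis unfolding L2[OF k] by simp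
    qed
    ultimately show "balanced lo (x # L) (y # R)"
      unfolding balanced_def by (auto simp: nth_Cons split: nat.splits)
  qed
qed

section \<open>Induction over the rounds\<close>

text \<open>The shape at the start of every round. The empty sites just beyond both ends receive the
  chips that then stay for good.\<close>

definition crowded :: "config \<Rightarrow> nat list \<Rightarrow> nat \<Rightarrow> nat \<Rightarrow> nat list \<Rightarrow> bool" where
  "crowded C L u w R \<longleftrightarrow> C 0 = {u, w} \<and>
     (\<forall>k<length L. C (- int k - 1) = {L ! k}) \<and> (\<forall>k<length R. C (int k + 1) = {R ! k}) \<and>
     C (- int (length L) - 1) = {} \<and> C (int (length R) + 1) = {}"

text \<open>The label of the chip at \<open>i\<close> in the sorted final configuration, in which the position \<open>r - l\<close>
  is vacant.\<close>

definition target :: "nat \<Rightarrow> nat \<Rightarrow> nat \<Rightarrow> int \<Rightarrow> nat" where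
  "target lo l r i = (if i < int r - int l then lo + nat (i + int l + 2) else lo + nat (i + int l + 1))"

definition sites :: "nat \<Rightarrow> nat \<Rightarrow> int set" where
  "sites l r = {- int l - 1..int r + 1} - {int r - int l}"

lemma sites_Suc: "sites (Suc l) (Suc r) = insert (- int l - 2) (insert (int r + 2) (sites l r))"
  by (auto simp: sites_def)

lemma target_Suc:
  "target lo (Suc l) (Suc r) (- int l - 2) = lo + 1"
  "target lo (Suc l) (Suc r) (int r + 2) = lo + l + r + 4"
  "i \<in> sites l r \<Longrightarrow> target lo (Suc l) (Suc r) i = target (lo + 1) l r i"
  by (auto simp: target_def sites_def nat_add_distrib)

text \<open>Formulated for the induction: sites beyond the ends stay untouched, so chips parked
  there by earlier rounds survive. One chip on each site but the hole is unconditional and gives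
  stability; sortedness is compared with \<open>balanced\<close> only when the labels form an
  interval, for every offset.\<close>

definition outcome :: "config \<Rightarrow> nat list \<Rightarrow> nat \<Rightarrow> nat \<Rightarrow> nat list \<Rightarrow> config \<Rightarrow> bool" where
  "outcome C L u w R D \<longleftrightarrow>
     (\<forall>i. i < - int (length L) - 1 \<or> i > int (length R) + 1 \<longrightarrow> D i = C i) \<and>
     D (int (length R) - int (length L)) = {} \<and>
     (\<forall>i\<in>sites (length L) (length R). \<exists>x. D i = {x}) \<and>
     (\<forall>lo. set (u # w # L @ R) = {lo + 1..lo + length L + length R + 2} \<longrightarrow>
       ((\<forall>i\<in>sites (length L) (length R). D i = {target lo (length L) (length R) i}) \<longleftrightarrow> balanced lo L R))"

lemma outcome_center:
  assumes C: "crowded C [] u w []" and uw: "u < w" and pos: "{-1..1} \<subseteq> positions n"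
  shows "\<exists>D. (topple n)\<^sup>*\<^sup>* C D \<and> outcome C [] u w [] D"
proof -
  let ?D = "swept 1 max min 0 u w [] C"
  have "(topple n)\<^sup>*\<^sup>* C ?D"
    by (rule topple_sweep) (use C uw pos in \<open>auto simp: crowded_def\<close>)
  moreover have D: "?D (-1) = {u}" "?D 0 = {}" "?D 1 = {w}"
    using C by (auto simp: swept_def crowded_def)
  have sites: "sites 0 0 = {-1, 1}" by (auto simp: sites_def)
  have "outcome C [] u w [] ?D"
  proof -
    have "?D i = C i" if "i < -1 \<or> i > 1" for i using that by (auto simp: swept_def Let_def)
    moreover have "u = lo + 1 \<and> w = lo + 2" if "{u, w} = {lo + 1..lo + 2}" for lo
    proof -
      have "lo + 1 \<in> {u, w}" "lo + 2 \<in> {u, w}" unfolding that by auto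
      then show ?thesis using uw by auto
    qed
    ultimately show ?thesis
      by (auto simp: outcome_def sites D target_def balanced_def)
  qed
  ultimately show ?thesis by blast
qed

text \<open>The base case for even n, where the right side has one chip more. Three labels with u <
  w come out sorted iff y is not the smallest.\<close>

lemma outcome_center_right:
  assumes C: "crowded C [] u w [y]" and uw: "u < w" and dist: "distinct [u, w, y]"
    and pos: "{-1..2} \<subseteq> positions n"
  shows "\<exists>D. (topple n)\<^sup>*\<^sup>* C D \<and> outcome C [] u w [y] D"
proof -
  let ?D = "swept 1 max min 0 u w [y] C"
  have "(topple n)\<^sup>*\<^sup>* C ?D"
    by (rule topple_sweep) (use C uw pos dist in \<open>auto simp: crowded_def\<close>)
  moreover have D: "?D (-1) = {u}" "?D 0 = {min y w}" "?D 1 = {}" "?D 2 = {max y w}"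
    using C by (auto simp: swept_def crowded_def)
  have sites: "sites 0 (Suc 0) = {-1, 0, 2}" by (auto simp: sites_def)
  have "outcome C [] u w [y] ?D"
  proof -
    have "?D i = C i" if "i < -1 \<or> i > 2" for i using that by (auto simp: swept_def Let_def)
    moreover have "u = lo + 1 \<and> min y w = lo + 2 \<and> max y w = lo + 3 \<longleftrightarrow> lo + 2 \<le> y"
      if "{u, w, y} = {lo + 1..lo + 3}" for lo
    proof -
      have "u \<in> {lo + 1..lo + 3}" "w \<in> {lo + 1..lo + 3}" "y \<in> {lo + 1..lo + 3}"
        unfolding that[symmetric] by auto
      then show ?thesis using uw dist by (cases "y \<le> w") auto
    qed
    ultimately show ?thesis
      by (auto simp: outcome_def sites D target_def balanced_def numeral_3_eq_3)
  qed
  ultimately show ?thesis by blast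
qed

lemma phase_step:
  assumes C: "crowded C (x # L) u w (y # R)" and uw: "u < w" and dist: "distinct (u # w # (x # L) @ y # R)"
    and pos: "{- int (length L) - 2..int (length R) + 2} \<subseteq> positions n"
  shows "\<exists>C'. (topple n)\<^sup>*\<^sup>* C C' \<and>
    crowded C' (deposits min max (min x u) L) (min (max x u) (min y w)) (max (max x u) (min y w))
      (deposits max min (max y w) R) \<and>
    C' (- int (length L) - 2) = {fold min L (min x u)} \<and> C' (int (length R) + 2) = {fold max R (max y w)} \<and>
    (\<forall>i. i < - int (length L) - 2 \<or> i > int (length R) + 2 \<longrightarrow> C' i = C i)"
proof -
  have C0: "C 0 = {u, w}" and CL: "\<And>k. k < Suc (length L) \<Longrightarrow> C (- int k - 1) = {(x # L) ! k}"
    and CR: "\<And>k. k < Suc (length R) \<Longrightarrow> C (int k + 1) = {(y # R) ! k}"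
    and Cl: "C (- int (length L) - 2) = {}" and Cr: "C (int (length R) + 2) = {}"
    using C by (auto simp: crowded_def algebra_simps)
  let ?C1 = "swept 1 max min 0 u w (y # R) C"
  \<comment> \<open>The right sweep drops u onto x at -1, where the left sweep starts. That one
    returns \<open>max x u\<close> to the origin, which already holds \<open>min y w\<close>, so the
    origin is doubled again.\<close>
  let ?C2 = "swept (-1) min max (-1) (max x u) (min x u) L ?C1"
  have C1: "?C1 (-1) = {u, x}" "?C1 0 = {min y w}"
    "?C1 (int (length R) + 1) = {}" "?C1 (int (length R) + 2) = {fold max R (max y w)}"
    using CL[of 0] by (simp_all add: swept_def Let_def)
  have C1_out: "?C1 i = C i" if "i < -1 \<or> i > int (length R) + 2" for i
    using that by (auto simp: swept_def Let_def)
  have C1_R: "?C1 (int k + 1) = {deposits max min (max y w) R ! k}" if "k < length R" for k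
  proof -
    have "nat (int k + 1) = Suc k" by simp
    then show ?thesis using that by (simp add: swept_def Let_def)
  qed
  have "(topple n)\<^sup>*\<^sup>* C ?C1"
  proof (rule topple_sweep)
    show "C (0 + 1 * (int k + 1)) = {(y # R) ! k}" if "k < length (y # R)" for k
      using CR[of k] that by simp
    show "C (0 + 1 * (int (length (y # R)) + 1)) = {}" using Cr by (simp add: add.commute)
    show "0 + 1 * k \<in> positions n" if "-1 \<le> k" "k \<le> int (length (y # R)) + 1" for k
    proof -
      have "k \<in> {- int (length L) - 2..int (length R) + 2}" using that by simp
      then show ?thesis using pos by auto
    qed
  qed (use C0 uw dist in \<open>simp_all\<close>)
  moreover have "(topple n)\<^sup>*\<^sup>* ?C1 ?C2"
  proof (rule topple_sweep)
    have xu: "x \<noteq> u" using dist by auto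
    have "{max x u, min x u} = {u, x}" by (cases "x \<le> u") auto
    then show "?C1 (-1) = {max x u, min x u}" using C1(1) by simp
    show "max x u \<noteq> min x u" using xu by (cases "x \<le> u") auto
    show "max x u = max (max x u) (min x u)" by (cases "x \<le> u") auto
    show "?C1 (-1 + -1 * (int k + 1)) = {L ! k}" if "k < length L" for k
    proof -
      have "-1 + -1 * (int k + 1) = - int (Suc k) - 1" by simp
      then have "?C1 (-1 + -1 * (int k + 1)) = C (- int (Suc k) - 1)" using C1_out by simp
      then show ?thesis using CL[of "Suc k"] that by simp
    qed
    have "-1 + -1 * (int (length L) + 1) = - int (length L) - 2" by simp
    moreover have "?C1 (- int (length L) - 2) = C (- int (length L) - 2)" by (rule C1_out) simp
    ultimately show "?C1 (-1 + -1 * (int (length L) + 1)) = {}" using Cl by (simp only:)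
    show "distinct (min x u # L)" using dist by (cases "x \<le> u") auto
    show "-1 + -1 * k \<in> positions n" if "-1 \<le> k" "k \<le> int (length L) + 1" for k
    proof -
      have "-1 + -1 * k \<in> {- int (length L) - 2..int (length R) + 2}" using that by simp
      then show ?thesis using pos by blast
    qed
  qed simp
  ultimately have "(topple n)\<^sup>*\<^sup>* C ?C2" by simp
  moreover have C2_R: "?C2 i = ?C1 i" if "0 < i \<or> i < - int (length L) - 2" for i
    using that by (auto simp: swept_def[of "-1"] Let_def)
  moreover have C2_0: "?C2 0 = {max x u, min y w}"
    by (simp add: swept_def[of "-1"] Let_def C1)
  moreover have C2_L: "?C2 (- int k - 1) = {deposits min max (min x u) L ! k}" if "k < length L" for k
    using that by (simp add: swept_def[of "-1"] Let_def)
  moreover have C2_l: "?C2 (- int (length L) - 1) = {}" "?C2 (- int (length L) - 2) = {fold min L (min x u)}"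
    by (simp_all add: swept_def[of "-1"] Let_def)
  moreover have "crowded ?C2 (deposits min max (min x u) L) (min (max x u) (min y w))
      (max (max x u) (min y w)) (deposits max min (max y w) R)"
  proof -
    have "{min (max x u) (min y w), max (max x u) (min y w)} = {max x u, min y w}"
      by (cases "max x u \<le> min y w") (auto simp: min_def max_def)
    then show ?thesis unfolding crowded_def
      using C2_0 C2_L C2_R C2_l C1 C1_R by simp
  qed
  moreover have "?C2 (int (length R) + 2) = {fold max R (max y w)}"
    by (subst C2_R) (simp_all add: C1)
  moreover have "\<forall>i. i < - int (length L) - 2 \<or> i > int (length R) + 2 \<longrightarrow> ?C2 i = C i"
    using C2_R C1_out by auto
  ultimately show ?thesis by (intro exI[of _ ?C2] conjI)
qed

lemma topple_outcome:
  assumes "crowded C L u w R" "u < w" "distinct (u # w # L @ R)"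
    "length L \<le> length R" "length R \<le> length L + 1"
    "{- int (length L) - 1..int (length R) + 1} \<subseteq> positions n"
  shows "\<exists>D. (topple n)\<^sup>*\<^sup>* C D \<and> outcome C L u w R D"
  using assms
proof (induction "length L" arbitrary: C L u w R)
  case 0
  then have L: "L = []" by simp
  show ?case
  proof (cases R)
    case Nil
    then show ?thesis using 0 outcome_center L by auto
  next
    case (Cons y R')
    then have "R = [y]" using 0 L by simp
    then show ?thesis using 0 outcome_center_right L by auto
  qed
next
  case (Suc l)
  then obtain x L' y R' where L: "L = x # L'" and R: "R = y # R'"
    by (cases L; cases R) auto
  let ?L = "deposits min max (min x u) L'" and ?R = "deposits max min (max y w) R'"
  let ?u = "min (max x u) (min y w)" and ?w = "max (max x u) (min y w)"
  let ?m = "fold min L' (min x u)" and ?M = "fold max R' (max y w)"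
  note C = Suc.prems(1)[unfolded L R] and uw = Suc.prems(2) and dist = Suc.prems(3)[unfolded L R]
  have "{- int (length L') - 2..int (length R') + 2} \<subseteq> positions n"
    using Suc.prems(6) L R by (simp add: algebra_simps)
  from phase_step[OF C uw dist this] obtain C' where C': "(topple n)\<^sup>*\<^sup>* C C'" "crowded C' ?L ?u ?w ?R"
    "C' (- int (length L') - 2) = {?m}" "C' (int (length R') + 2) = {?M}"
    "\<forall>i. i < - int (length L') - 2 \<or> i > int (length R') + 2 \<longrightarrow> C' i = C i" by (elim exE conjE)
  \<comment> \<open>A round only rearranges chips, which transfers distinctness and the set of
    labels.\<close>
  have mset: "mset (?m # ?M # ?u # ?w # ?L @ ?R) = mset (u # w # (x # L') @ y # R')"
  proof -
    have swap: "{#min a b, max a b#} = {#a, b#}" "{#max a b, min a b#} = {#a, b#}" for a b :: nat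
      by (cases "a \<le> b"; simp add: min_def max_def add_mset_commute)+
    have "mset (?m # ?M # ?u # ?w # ?L @ ?R) =
        add_mset ?m (mset ?L) + add_mset ?M (mset ?R) + {#?u, ?w#}" by simp
    also have "\<dots> = add_mset (min x u) (mset L') + add_mset (max y w) (mset R') + {#max x u, min y w#}"
      unfolding mset_deposits[OF swap(1)] mset_deposits[OF swap(2)] swap(1)[of "max x u" "min y w"] ..
    also have "\<dots> = {#min x u, max x u#} + {#min y w, max y w#} + mset L' + mset R'"
      by (simp add: add_mset_commute)
    also have "\<dots> = mset (u # w # (x # L') @ y # R')"
      unfolding swap by simp
    finally show ?thesis .
  qed
  then have dist': "distinct (?m # ?M # ?u # ?w # ?L @ ?R)" using dist mset_eq_imp_distinct_iff by blast
  have set': "set (?m # ?M # ?u # ?w # ?L @ ?R) = set (u # w # (x # L') @ y # R')"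
    by (rule mset_eq_setD[OF mset])
  have "?u < ?w" using dist' by (auto simp: min_def max_def)
  moreover have "distinct (?u # ?w # ?L @ ?R)" using dist' by simp
  moreover have "{- int (length ?L) - 1..int (length ?R) + 1} \<subseteq> positions n"
    using Suc.prems(6) L R by auto
  ultimately obtain D where D: "(topple n)\<^sup>*\<^sup>* C' D" "outcome C' ?L ?u ?w ?R D"
    using Suc.hyps(1)[of ?L C' ?u ?w ?R] Suc.hyps(2) Suc.prems(4,5) C'(2) L R by auto
  have Dm: "D (- int (length L') - 2) = {?m}" "D (int (length R') + 2) = {?M}"
    using D(2) C'(3,4) by (auto simp: outcome_def)
  have "outcome C L u w R D"
    unfolding outcome_def
  proof (intro conjI allI impI)
    fix i assume "i < - int (length L) - 1 \<or> int (length R) + 1 < i"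
    then show "D i = C i" using D(2) C'(5) L R by (auto simp: outcome_def)
  next
    show "D (int (length R) - int (length L)) = {}" using D(2) L R by (simp add: outcome_def)
  next
    show "\<forall>i\<in>sites (length L) (length R). \<exists>x. D i = {x}"
      using D(2) Dm L R by (simp add: outcome_def sites_Suc)
  next
    fix lo assume labels: "set (u # w # L @ R) = {lo + 1..lo + length L + length R + 2}"
    let ?N = "length L' + length R' + 4"
    have labels': "set (u # w # (x # L') @ y # R') = {lo + 1..lo + ?N}" using labels L R by simp
    have "(\<forall>i\<in>sites (length L) (length R). D i = {target lo (length L) (length R) i}) \<longleftrightarrow>
      ?m = lo + 1 \<and> ?M = lo + ?N \<and>
      (\<forall>i\<in>sites (length L') (length R'). D i = {target (lo + 1) (length L') (length R') i})"
      unfolding L R length_Cons sites_Suc using Dm target_Suc by (simp add: add.assoc)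
    also have "\<dots> \<longleftrightarrow> ?m = lo + 1 \<and> ?M = lo + ?N \<and> balanced (lo + 1) ?L ?R"
    \<comment> \<open>That the remaining labels form an interval is known only when the two parked
      chips are the extreme ones, hence the conditional congruence.\<close>
    proof (intro conj_cong refl)
      assume m: "?m = lo + 1" and M: "?M = lo + ?N"
      have "set (?u # ?w # ?L @ ?R) = set (?m # ?M # ?u # ?w # ?L @ ?R) - {?m, ?M}"
        using dist' by auto
      also have "\<dots> = {lo + 1..lo + ?N} - {lo + 1, lo + ?N}" unfolding set' labels' unfolding m M ..
      also have "\<dots> = {(lo + 1) + 1..(lo + 1) + length ?L + length ?R + 2}" by auto
      finally have "set (?u # ?w # ?L @ ?R) = {(lo + 1) + 1..(lo + 1) + length ?L + length ?R + 2}" .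
      then have "(\<forall>i\<in>sites (length ?L) (length ?R). D i = {target (lo + 1) (length ?L) (length ?R) i})
          \<longleftrightarrow> balanced (lo + 1) ?L ?R"
        using D(2) unfolding outcome_def by blast
      then show "(\<forall>i\<in>sites (length L') (length R'). D i = {target (lo + 1) (length L') (length R') i})
          \<longleftrightarrow> balanced (lo + 1) ?L ?R" by simp
    qed
    also have "\<dots> \<longleftrightarrow> balanced lo L R"
      unfolding L R by (rule balanced_step[OF uw dist labels'])
    finally show "(\<forall>i\<in>sites (length L) (length R). D i = {target lo (length L) (length R) i}) \<longleftrightarrow> balanced lo L R" .
  qed
  then show ?case using C'(1) D(1) by (meson rtranclp_trans)
qed

section \<open>From toppling to the band condition\<close>

definition chip :: "(nat \<Rightarrow> nat) \<Rightarrow> nat \<Rightarrow> nat \<Rightarrow> nat" where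
  "chip \<pi> r j = (if \<pi> j < r then \<pi> j else \<pi> j + 1)"

lemma chip_neq: "chip \<pi> r j \<noteq> r"
  by (simp add: chip_def)

lemma initial_config_eq:
  assumes n: "n = a + q" "a = (n - 1) div 2" "0 < n"
  shows "initial_config n \<pi> r i =
    (if - int a \<le> i \<and> i < int q then {chip \<pi> r (nat (i + int a + 1))} else {}) \<union> (if i = 0 then {r} else {})"
proof -
  have a: "(int n - 1) div 2 = int a" using n(2,3) by (simp add: of_nat_diff zdiv_int)
  have "{if \<pi> j < r then \<pi> j else \<pi> j + 1 | j. j \<in> {1..n} \<and> i = - int a + int j - 1} =
    (if - int a \<le> i \<and> i < int q then {chip \<pi> r (nat (i + int a + 1))} else {})"
  proof -
    have "j \<in> {1..n} \<and> i = - int a + int j - 1 \<longleftrightarrow> - int a \<le> i \<and> i < int q \<and> j = nat (i + int a + 1)" for j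
      using n(1) by auto
    then show ?thesis by (auto simp: chip_def)
  qed
  then show ?thesis unfolding initial_config_def a by simp
qed

lemma sorted_list_of_set_int_interval: "sorted_list_of_set {i..j} = [i..j :: int]"
  using sorted_list_of_set.idem_if_sorted_distinct[of "[i..j]"] by simp

lemma read_config_eq_identity_iff:
  assumes pos: "positions n = {- int l - 1..int r + 1}" and n: "n = l + r + 1" and lr: "l \<le> r" "r \<le> l + 1"
    and hole: "D (int r - int l) = {}" and single: "\<forall>i\<in>sites l r. \<exists>x. D i = {x}"
  shows "(\<forall>k\<in>{1..n + 1}. read_config n D ! (k - 1) = k) \<longleftrightarrow> (\<forall>i\<in>sites l r. D i = {target 0 l r i})"
proof -
  define d where "d = (\<lambda>i. the_elem (D i))"
  define ps where "ps = [- int l - 1..int r - int l - 1] @ [int r - int l + 1..int r + 1]"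
  have set_ps: "set ps = sites l r" using lr by (auto simp: ps_def sites_def)
  have len: "length ps = n + 1" using n lr by (simp add: ps_def)
  have d: "D i = {d i}" if "i \<in> set ps" for i
    using single that unfolding set_ps d_def by fastforce
  have "[- int l - 1..int r + 1] = [- int l - 1..int r - int l - 1] @ (int r - int l) # [int r - int l + 1..int r + 1]"
    using lr by (intro upto_split3) auto
  then have "read_config n D = concat (map (\<lambda>i. sorted_list_of_set (D i)) ps)"
    unfolding read_config_def pos sorted_list_of_set_int_interval by (simp add: ps_def hole)
  also have "map (\<lambda>i. sorted_list_of_set (D i)) ps = map (\<lambda>i. [d i]) ps"
    using d by (intro map_cong refl) simp
  also have "concat \<dots> = map d ps" by simp
  finally have read: "read_config n D = map d ps" .
  have len1: "length [- int l - 1..int r - int l - 1] = r + 1" by (simp add: nat_add_distrib)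
  have target: "target 0 l r (ps ! k) = k + 1" if "k < n + 1" for k
  proof (cases "k < r + 1")
    case True
    then have "ps ! k = - int l - 1 + int k"
      unfolding ps_def nth_append len1 by (simp add: nth_upto)
    then show ?thesis using True by (simp add: target_def)
  next
    case False
    then have "ps ! k = int r - int l + 1 + int (k - (r + 1))"
      using that n unfolding ps_def nth_append len1 by (simp add: nth_upto)
    then show ?thesis using False by (simp add: target_def)
  qed
  have "(\<forall>k\<in>{1..n + 1}. read_config n D ! (k - 1) = k) \<longleftrightarrow> (\<forall>k<n + 1. map d ps ! k = k + 1)"
    unfolding read
  proof (intro iffI ballI allI impI)
    fix k assume "\<forall>k\<in>{1..n + 1}. map d ps ! (k - 1) = k" "k < n + 1"
    then show "map d ps ! k = k + 1" by (auto dest: bspec[of _ _ "k + 1"])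
  next
    fix k assume a: "\<forall>k<n + 1. map d ps ! k = k + 1" and "k \<in> {1..n + 1}"
    then have "k - 1 < n + 1" "k - 1 + 1 = k" by auto
    then show "map d ps ! (k - 1) = k" using a by metis
  qed
  also have "\<dots> \<longleftrightarrow> (\<forall>k<length ps. d (ps ! k) = target 0 l r (ps ! k))"
    using target len by auto
  also have "\<dots> \<longleftrightarrow> (\<forall>i\<in>set ps. d i = target 0 l r i)" by (metis in_set_conv_nth)
  also have "\<dots> \<longleftrightarrow> (\<forall>i\<in>sites l r. D i = {target 0 l r i})" using d unfolding set_ps by auto
  finally show ?thesis .
qed

text \<open>The two halves of \<open>balanced\<close> at offset 0. The chip of \<pi> (a + 1) starts
  at the origin together with r, so neither is constrained.\<close>

lemma r_toppleable_iff:
  assumes n: "n = a + q" "a = (n - 1) div 2" "0 < n"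
    and \<pi>: "\<pi> permutes {1..n}" and r: "r \<in> {1..n + 1}"
  shows "r_toppleable n r \<pi> \<longleftrightarrow>
    (\<forall>k<q - 1. k + 2 \<le> chip \<pi> r (a + 2 + k)) \<and> (\<forall>k<a. chip \<pi> r (a - k) + k \<le> n)"
proof -
  let ?C = "initial_config n \<pi> r"
  \<comment> \<open>Both lists run outwards from the origin, so the left one visits a, a - 1, ...,
    1.\<close>
  define L where "L = map (\<lambda>k. chip \<pi> r (a - k)) [0..<a]"
  define R where "R = map (\<lambda>k. chip \<pi> r (a + 2 + k)) [0..<q - 1]"
  define u where "u = min (chip \<pi> r (a + 1)) r"
  define w where "w = max (chip \<pi> r (a + 1)) r"
  note C = initial_config_eq[OF n, of \<pi> r]
  have "n = 2 * a + 1 \<or> n = 2 * a + 2" using n(2,3) by linarith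
  then have q: "q = a + 1 \<or> q = a + 2" "q = n div 2 + 1" using n(1) by auto
  have pos: "positions n = {- int a - 1..int (q - 1) + 1}"
  proof -
    have "(int n + 1) div 2 = int a + 1" "int n div 2 + 1 = int q" using n q by (auto simp: zdiv_int)
    then show ?thesis using q by (simp add: positions_def)
  qed
  have uw: "u < w" "{u, w} = {chip \<pi> r (a + 1), r}"
    using chip_neq[of \<pi> r "a + 1"] by (auto simp: u_def w_def min_def max_def)
  have crowded: "crowded ?C L u w R"
    unfolding crowded_def uw(2) using q
    by (auto simp: C L_def R_def nat_add_distrib nat_diff_distrib algebra_simps)
  have labels: "set (u # w # L @ R) = {1..n + 1}"
  proof -
    have "set L = chip \<pi> r ` {1..a}"
    proof -
      have "(\<lambda>k. a - k) ` {0..<a} = {1..a}"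
      proof (intro equalityI subsetI)
        fix j assume "j \<in> {1..a}"
        then show "j \<in> (\<lambda>k. a - k) ` {0..<a}" by (intro image_eqI[of _ _ "a - j"]) auto
      qed auto
      then show ?thesis unfolding L_def by (simp only: set_map set_upt image_image[symmetric, of "chip \<pi> r" "\<lambda>k. a - k"])
    qed
    moreover have "set R = chip \<pi> r ` {a + 2..n}"
    proof -
      have "(\<lambda>k. k + (a + 2)) ` {0..<q - 1} = {a + 2..<q - 1 + (a + 2)}"
        by (subst image_add_atLeastLessThan') simp
      also have "{a + 2..<q - 1 + (a + 2)} = {a + 2..n}" using n(1) q(1) by auto
      finally have "(\<lambda>k. a + 2 + k) ` {0..<q - 1} = {a + 2..n}" by (simp only: add.commute)
      then show ?thesis unfolding R_def by (simp only: set_map set_upt image_image[symmetric, of "chip \<pi> r" "\<lambda>k. a + 2 + k"])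
    qed
    moreover have "{1..n} = insert (a + 1) ({1..a} \<union> {a + 2..n})" using n q by auto
    ultimately have "set (u # w # L @ R) = insert r (chip \<pi> r ` {1..n})" using uw(2) by auto
    also have "chip \<pi> r ` {1..n} = (\<lambda>v. if v < r then v else v + 1) ` \<pi> ` {1..n}"
      by (auto simp: chip_def image_image)
    also have "\<pi> ` {1..n} = {1..n}" using \<pi> by (rule permutes_image)
    also have "insert r ((\<lambda>v. if v < r then v else v + 1) ` {1..n}) = {1..n + 1}"
    proof (intro equalityI subsetI)
      fix v assume v: "v \<in> {1..n + 1}"
      consider "v = r" | "v < r" | "r < v" by linarith
      then show "v \<in> insert r ((\<lambda>v. if v < r then v else v + 1) ` {1..n})"
      proof cases
        case 2
        then show ?thesis using v r by (intro insertI2 image_eqI[of _ _ v]) auto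
      next
        case 3
        then show ?thesis using v r by (intro insertI2 image_eqI[of _ _ "v - 1"]) auto
      qed simp
    qed (use r in auto)
    finally show ?thesis .
  qed
  have len: "length L = a" "length R = q - 1" by (simp_all add: L_def R_def)
  have "length (u # w # L @ R) = n + 1" using len n(1) q(1) by auto
  then have "distinct (u # w # L @ R)"
    by (intro card_distinct) (simp only: labels card_atLeastAtMost diff_Suc_1 Suc_eq_plus1)
  moreover have "length L \<le> length R" "length R \<le> length L + 1" using len q by auto
  moreover have "{- int (length L) - 1..int (length R) + 1} \<subseteq> positions n" using pos len by simp
  ultimately obtain D where D: "(topple n)\<^sup>*\<^sup>* ?C D" "outcome ?C L u w R D"
    using topple_outcome[OF crowded uw(1)] by blast
  have out: "D i = {}" if "i < - int a - 1 \<or> i > int (q - 1) + 1" for i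
    using D(2) that len q by (auto simp: outcome_def C)
  have hole: "D (int (q - 1) - int a) = {}" and single: "\<forall>i\<in>sites a (q - 1). \<exists>x. D i = {x}"
    using D(2) len by (simp_all add: outcome_def)
  have "stable D"
    unfolding stable_def
  proof
    fix i
    have "i \<in> sites a (q - 1) \<or> D i = {}" using out[of i] hole unfolding sites_def
      by (cases "i < - int a - 1 \<or> i > int (q - 1) + 1"; cases "i = int (q - 1) - int a") force+
    then show "\<forall>\<alpha>\<in>D i. \<forall>\<beta>\<in>D i. \<alpha> = \<beta>" using single by fastforce
  qed
  moreover have "alternating ?C"
  proof -
    have "i = 0" if "card (?C i) = 2" for i using that by (auto simp: C split: if_splits)
    moreover have "finite (?C i) \<and> card (?C i) \<le> 2" for i
      by (auto simp: C card_insert_if)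
    ultimately show ?thesis unfolding alternating_def by (metis less_irrefl)
  qed
  ultimately have final: "final_config n \<pi> r = D"
    unfolding final_config_def using D(1) stable_unique by (intro the_equality) auto
  have "r_toppleable n r \<pi> \<longleftrightarrow> (\<forall>k\<in>{1..n + 1}. read_config n D ! (k - 1) = k)"
    unfolding r_toppleable_def toppling_perm_def final fun_eq_iff by auto
  also have "\<dots> \<longleftrightarrow> (\<forall>i\<in>sites a (q - 1). D i = {target 0 a (q - 1) i})"
    using n q by (intro read_config_eq_identity_iff[OF pos _ _ _ hole single]) auto
  also have "\<dots> \<longleftrightarrow> balanced 0 L R"
  proof -
    have "0 + length L + length R + 2 = n + 1" using n len q by auto
    then show ?thesis using D(2) labels unfolding outcome_def len by (metis add_0)
  qed
  also have "\<dots> \<longleftrightarrow> (\<forall>k<q - 1. k + 2 \<le> chip \<pi> r (a + 2 + k)) \<and> (\<forall>k<a. chip \<pi> r (a - k) + k \<le> n)"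
  proof -
    have "R ! k = chip \<pi> r (a + 2 + k)" if "k < q - 1" for k using that by (simp add: R_def)
    moreover have "L ! k = chip \<pi> r (a - k)" if "k < a" for k using that by (simp add: L_def)
    moreover have "0 + a + (q - 1) + 1 = n" using n(1) q(1) by auto
    ultimately show ?thesis unfolding balanced_def len by simp
  qed
  finally show ?thesis .
qed

text \<open>A chip carries \<pi> j or \<pi> j + 1. The upper bounds on the left are hardest for r =
  1, which raises every label, and the lower bounds on the right for r = n + 1, which raises none;
  these two values already give the band.\<close>

lemma toppleable_iff:
  assumes n: "n = a + q" "a = (n - 1) div 2" "0 < n" and \<pi>: "\<pi> permutes {1..n}"
  shows "toppleable n \<pi> \<longleftrightarrow>
    (\<forall>j\<in>{1..a}. \<pi> j < j + q) \<and> (\<forall>j\<in>{a + 1..a + q}. j \<le> \<pi> j + a)" (is "_ \<longleftrightarrow> ?band")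
proof
  assume t: "toppleable n \<pi>"
  have \<pi>_in: "\<pi> j \<in> {1..n}" if "j \<in> {1..n}" for j using permutes_in_image[OF \<pi>] that by blast
  have "\<pi> j < j + q" if j: "j \<in> {1..a}" for j
  proof -
    have "r_toppleable n 1 \<pi>" using t by (simp add: toppleable_def)
    then have "\<forall>k<a. chip \<pi> 1 (a - k) + k \<le> n" using r_toppleable_iff[OF n \<pi>, of 1] by simp
    moreover have "a - j < a" "a - (a - j) = j" using j by auto
    ultimately have "chip \<pi> 1 j + (a - j) \<le> n" by metis
    moreover have "chip \<pi> 1 j = \<pi> j + 1" using \<pi>_in[of j] j n(1) by (simp add: chip_def)
    ultimately show ?thesis using n(1) j by simp
  qed
  moreover have "j \<le> \<pi> j + a" if j: "j \<in> {a + 1..a + q}" for j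
  \<comment> \<open>The chip at the origin is not constrained by the rounds; here the band
    inequality only says \<pi> j \<ge> 1.\<close>
  proof (cases "j = a + 1")
    case True
    then show ?thesis using \<pi>_in[of j] j n(1) by simp
  next
    case False
    have "r_toppleable n (n + 1) \<pi>" using t by (simp add: toppleable_def)
    then have "\<forall>k<q - 1. k + 2 \<le> chip \<pi> (n + 1) (a + 2 + k)" using r_toppleable_iff[OF n \<pi>, of "n + 1"] by simp
    moreover have "j - (a + 2) < q - 1" "a + 2 + (j - (a + 2)) = j" using j False by auto
    ultimately have "j - (a + 2) + 2 \<le> chip \<pi> (n + 1) j" by metis
    moreover have "chip \<pi> (n + 1) j = \<pi> j" using \<pi>_in[of j] j n(1) by (simp add: chip_def)
    ultimately show ?thesis by simp
  qed
  ultimately show ?band by blast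
next
  assume b: ?band
  show "toppleable n \<pi>"
    unfolding toppleable_def
  proof
    fix r assume r: "r \<in> {1..n + 1}"
    have "k + 2 \<le> chip \<pi> r (a + 2 + k)" if "k < q - 1" for k
    proof -
      have "a + 2 + k \<in> {a + 1..a + q}" using that by auto
      then have "a + 2 + k \<le> \<pi> (a + 2 + k) + a" using b by blast
      then show ?thesis by (simp add: chip_def)
    qed
    moreover have "chip \<pi> r (a - k) + k \<le> n" if "k < a" for k
    proof -
      have "a - k \<in> {1..a}" using that by auto
      then have "\<pi> (a - k) < a - k + q" using b by blast
      then show ?thesis using that n(1) by (auto simp: chip_def)
    qed
    ultimately show "r_toppleable n r \<pi>" using r_toppleable_iff[OF n \<pi> r] by blast
  qed
qed

theorem theorem2p5:
  fixes n :: nat and G :: "('a, 'b) pre_digraph" and v :: 'a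
  assumes "n \<ge> 2"
    and "complete_bipartite_digraph ((n + 1) div 2) (n div 2 + 1) G"
    and "v \<in> verts G"
  shows "num_toppleable n = card {D \<in> acyclic_orientations G. sinks G D = {v}}"
proof -
  define a where "a = (n - 1) div 2"
  define q where "q = n div 2 + 1"
  have "n = 2 * a + 1 \<or> n = 2 * a + 2" using assms(1) unfolding a_def by linarith
  then have n: "n = a + q" "0 < n" and parts: "(n + 1) div 2 = Suc a" "n div 2 + 1 = Suc (n div 2)"
    by (auto simp: q_def)
  have "num_toppleable n = card {\<pi>. \<pi> permutes {1..n} \<and>
      (\<forall>j\<in>{1..a}. \<pi> j < j + q) \<and> (\<forall>j\<in>{a + 1..a + q}. j \<le> \<pi> j + a)}"
    unfolding num_toppleable_def using toppleable_iff[OF n(1) a_def n(2)]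
    by (intro arg_cong[where f = card] Collect_cong conj_cong refl)
  also have "\<dots> = (\<Sum>k\<le>a. (fact k)\<^sup>2 * Stirling a k * Stirling (Suc q) (Suc k))"
    unfolding n(1) by (rule card_band_permutations)
  \<comment> \<open>The parts have a + 1 and q = n div 2 + 1 vertices, so n div 2 takes the place of
    q in the graph count, and \<open>Suc (Suc (n div 2))\<close> there is \<open>Suc q\<close>
    here.\<close>
  also have "\<dots> = card {D \<in> acyclic_orientations G. sinks G D = {v}}"
    using card_unique_sink_orientations_complete_bipartite[of a "n div 2" G v] assms(2,3)
    unfolding parts by (simp add: q_def)
  finally show ?thesis .
qed

end
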